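(* There are exactly four Dyer-Lashof algebra structures on $\mathbb F_2[u]$ (with $\deg u=2$) compatible with the multiplication.
   Context: The mod 2 Dyer-Lashof algebra $\mathcal R$ is generated by $Q^i$, $i\ge0$, $\deg Q^i=i$, with Adem relations $Q^iQ^j=\sum_k\binom{k-j-1}{2k-i}Q^{i+j-k}Q^k$ for $i>2j$. A Dyer-Lashof algebra structure on the graded ring $\mathbb F_2[u]$ compatible with the multiplication means an allowable $\mathcal R$-algebra structure: additive operations $Q^i$ raising degree by $i$, satisfying the Adem relations, the Cartan formula $Q^n(xy)=\sum_{i+j=n}Q^i(x)Q^j(y)$, $Q^i(1)=0$ for $i\ne0$ and $Q^0(1)=1$, $Q^ix=0$ for $i<\deg x$, and $Q^{\deg x}x=x^2$. *)

theory Defs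
  imports "HOL-Computational_Algebra.Polynomial" "HOL-Library.Z2"
begin

text \<open>
  Allowable algebras over the mod 2 Dyer-Lashof algebra. Here \<open>A d\<close> is the set of homogeneous
  elements of degree \<open>d\<close> of the underlying graded commutative ring of characteristic 2, and
  \<open>Q i\<close> is the action of the generator \<open>Q\<^sup>i\<close>; additivity makes it determined by its values on
  homogeneous elements. In the Adem relation with \<open>i > 2 * j\<close>, the condition \<open>i \<le> 2 * k\<close> only
  discards binomial coefficients with negative lower entry. It implies \<open>k \<ge> j + 1\<close>, so neither
  of the natural-number subtractions inside the binomial coefficient is truncated; the condition
  \<open>k \<le> i + j\<close> is there because there are no operations of negative index.
\<close>

locale dyer_lashof_algebra =
  fixes A :: "nat \<Rightarrow> 'a::comm_ring_1 set"
    and Q :: "nat \<Rightarrow> 'a \<Rightarrow> 'a"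
  assumes additive: "\<And>i x y. Q i (x + y) = Q i x + Q i y"
    and degree: "\<And>i d x. x \<in> A d \<Longrightarrow> Q i x \<in> A (d + i)"
    and adem: "\<And>i j x. i > 2 * j \<Longrightarrow>
      Q i (Q j x) =
        (\<Sum>k | i \<le> 2 * k \<and> k \<le> i + j.
           of_nat ((k - j - 1) choose (2 * k - i)) * Q (i + j - k) (Q k x))"
    and cartan: "\<And>n x y. Q n (x * y) = (\<Sum>(i, j) | i + j = n. Q i x * Q j y)"
    and unit: "\<And>i. i \<noteq> 0 \<Longrightarrow> Q i 1 = 0" "Q 0 1 = 1"
    and unstable: "\<And>i d x. x \<in> A d \<Longrightarrow> i < d \<Longrightarrow> Q i x = 0"
    and square: "\<And>d x. x \<in> A d \<Longrightarrow> Q d x = x ^ 2"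

text \<open>
  The polynomial ring \<open>F\<^sub>2[u]\<close> is \<^typ>\<open>bit poly\<close>, with \<open>u\<close> the indeterminate \<open>[:0, 1:]\<close>
  placed in degree 2: \<open>u\<^sup>n\<close> spans degree \<open>2 * n\<close>, and the odd degrees are zero.
\<close>

definition F2u_grading :: "nat \<Rightarrow> bit poly set" where
  "F2u_grading d = {p. \<forall>n. coeff p n \<noteq> 0 \<longrightarrow> 2 * n = d}"

end

theory Submission
  imports Defs "HOL-Computational_Algebra.Formal_Power_Series"
begin

text \<open>
  Degree reasons give \<open>Q\<^sup>2\<^sup>m u = a\<^sub>m u\<^sup>m\<^sup>+\<^sup>1\<close> with \<open>a\<^sub>m\<close> in \<open>F\<^sub>2\<close>, and make the odd operations vanish on \<open>u\<close>. The
  Cartan formula makes the total operation \<open>\<Sum> Q\<^sup>i z\<^sup>i\<close> a ring homomorphism, so a structure is the same as the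
  series \<open>A = \<Sum> a\<^sub>m z\<^sup>m\<close>. Instability says \<open>a\<^sub>0 = 0\<close>, the squaring axiom says \<open>a\<^sub>1 = 1\<close>, and every such series
  satisfies all the axioms except possibly the Adem relations. The theorem counts the series for which these hold.

  The Adem relations follow by a residue computation (\<open>residue_inversion\<close>) if the
  series \<open>A(s) A(t (s + t) A(s) / s)\<close> is symmetric in \<open>s\<close> and \<open>t\<close> (\<open>symmetric_series_imp_adem_relations\<close>). This can be checked for four series,
  each of which is given by an algebraic equation: \<open>z\<close>, \<open>z / (1 + z)\<close>, \<open>z / (1 + z\<^sup>2)\<close>, and \<open>y\<^sup>2 / z\<close> where
  \<open>y\<^sup>2 + y = z\<close>.

  That there are no others follows from the Adem relations on \<open>u\<close> for \<open>Q\<^sup>2\<^sup>i Q\<^sup>2\<^sup>j\<close> with \<open>j = 2, 3, 5\<close>, read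
  as recursions for the \<open>a\<^sub>m\<close>. If \<open>a\<^sub>2 = 1\<close> they determine \<open>A\<close>. If \<open>a\<^sub>2 = 0\<close> and \<open>a\<^sub>3 = 1\<close> they determine \<open>A\<close> from \<open>a\<^sub>5\<close>.
  If \<open>a\<^sub>2 = a\<^sub>3 = 0\<close>, one further relation shows that \<open>A = z\<close>. The four series realize
  the four possibilities, so uniqueness is proved by comparison with them and no recursion has to be solved.
\<close>

unbundle fps_syntax

section \<open>Power series over the field with two elements\<close>

lemma bit_add_self: "x + x = 0" for x :: bit
  by (cases x) simp_all

lemma bit_fps_add_self: "f + f = 0" for f :: "bit fps"
  by (rule fps_ext) (simp only: fps_add_nth bit_add_self fps_zero_nth)

lemma bit_fps2_add_self: "f + f = 0" for f :: "bit fps fps"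
  by (rule fps_ext) (simp only: fps_add_nth bit_fps_add_self fps_zero_nth)

text \<open>
  Squaring is additive in characteristic 2: in the convolution sum the terms at \<open>k\<close> and \<open>n - k\<close> cancel,
  so only the middle one is left.
\<close>

lemma bit_fps_square_nth:
  fixes f :: "bit fps"
  shows "(f ^ 2) $ n = (if even n then f $ (n div 2) else 0)"
proof -
  define g where "g = (\<lambda>k. f $ k * f $ (n - k))"
  have split: "{..n} = {k. k \<le> n \<and> 2 * k < n} \<union> ({k. k \<le> n \<and> 2 * k > n} \<union> {k. 2 * k = n})"
    by auto
  have fin: "finite {k. k \<le> n \<and> 2 * k < n}" "finite {k. k \<le> n \<and> 2 * k > n}" "finite {k. 2 * k = n}"
    by (auto intro: finite_subset[of _ "{..n}"])
  have mirror: "sum g {k. k \<le> n \<and> 2 * k > n} = sum g {k. k \<le> n \<and> 2 * k < n}"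
    by (rule sum.reindex_bij_witness[of _ "\<lambda>k. n - k" "\<lambda>k. n - k"]) (auto simp: g_def)
  have "(f ^ 2) $ n = sum g {..n}"
    by (simp add: fps_square_nth g_def)
  also have "\<dots> = sum g {k. k \<le> n \<and> 2 * k < n} + (sum g {k. k \<le> n \<and> 2 * k > n} + sum g {k. 2 * k = n})"
  proof -
    have "sum g ({k. k \<le> n \<and> 2 * k > n} \<union> {k. 2 * k = n}) = sum g {k. k \<le> n \<and> 2 * k > n} + sum g {k. 2 * k = n}"
      by (rule sum.union_disjoint) (use fin in auto)
    moreover have "sum g {..n} = sum g {k. k \<le> n \<and> 2 * k < n} + sum g ({k. k \<le> n \<and> 2 * k > n} \<union> {k. 2 * k = n})"
      unfolding split by (rule sum.union_disjoint) (use fin in auto)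
    ultimately show ?thesis by (simp only:)
  qed
  also have "\<dots> = sum g {k. 2 * k = n}"
    by (simp only: mirror add.assoc[symmetric] bit_add_self add_0_left)
  also have "\<dots> = (if even n then f $ (n div 2) else 0)"
  proof (cases "even n")
    case True
    then have "{k. 2 * k = n} = {n div 2}" by auto
    then show ?thesis using True by (simp add: g_def) (cases "f $ (n div 2)"; force)
  next
    case False
    then have "{k. 2 * k = n} = {}" by auto
    then show ?thesis using False by simp
  qed
  finally show ?thesis .
qed

lemma bit_fps_even_power_nth:
  fixes f :: "bit fps"
  shows "(f ^ (2 * n)) $ m = (if even m then (f ^ n) $ (m div 2) else 0)"
  by (simp add: bit_fps_square_nth power_mult mult.commute[of 2] del: power_bit_unfold)

lemma one_plus_X_power_nth: "((1 + fps_X :: bit fps) ^ n) $ m = of_nat (n choose m)"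
proof (induction n arbitrary: m)
  case 0
  then show ?case by (cases m) auto
next
  case (Suc n)
  then show ?case by (cases m) (auto simp: distrib_right)
qed

lemma choose_even_odd_bit: "(of_nat ((2 * n) choose (2 * m + 1)) :: bit) = 0"
proof -
  have "(of_nat ((2 * n) choose (2 * m + 1)) :: bit) = ((1 + fps_X) ^ (2 * n)) $ (2 * m + 1)"
    by (rule one_plus_X_power_nth[symmetric])
  then show ?thesis by (simp only: bit_fps_even_power_nth) simp
qed

lemma choose_odd_even_bit: "(of_nat ((2 * n + 1) choose (2 * m)) :: bit) = of_nat (n choose m)"
proof -
  have "(of_nat ((2 * n) choose (2 * m)) :: bit) = ((1 + fps_X) ^ (2 * n)) $ (2 * m)"
    by (rule one_plus_X_power_nth[symmetric])
  also have "\<dots> = of_nat (n choose m)"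
    by (simp only: bit_fps_even_power_nth one_plus_X_power_nth) simp
  finally show ?thesis
    using choose_even_odd_bit[of n "m - 1"] by (cases m) auto
qed

text \<open>
  The coefficient is \<open>2 m choose m\<close> up to sign, which is even for \<open>m > 0\<close>. Splitting off squares
  replaces \<open>m = 2 p\<close> by \<open>p\<close>.
\<close>

lemma inverse_one_plus_X_power_diagonal:
  "m > 0 \<Longrightarrow> (inverse (1 + fps_X :: bit fps) ^ (m + 1)) $ m = 0"
proof (induction m rule: less_induct)
  case (less m)
  let ?I = "inverse (1 + fps_X :: bit fps)"
  show ?case
  proof (cases "even m")
    case False
    then obtain p where "m = 2 * p + 1" by (metis oddE)
    then have "?I ^ (m + 1) = ?I ^ (2 * (p + 1))" by simp
    then show ?thesis using False by (simp only: bit_fps_even_power_nth if_False)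
  next
    case True
    then obtain p where p: "m = 2 * p" by blast
    have inv: "?I * (1 + fps_X) = 1" by (rule inverse_mult_eq_1) simp
    have "?I ^ (m + 1) = ?I ^ (2 * p + 1) * (?I * (1 + fps_X))" by (simp add: inv p)
    also have "\<dots> = ?I ^ (2 * (p + 1)) + fps_X * ?I ^ (2 * (p + 1))"
      by (simp add: algebra_simps)
    finally have "(?I ^ (m + 1)) $ m = (?I ^ (2 * (p + 1))) $ m + (if m = 0 then 0 else (?I ^ (2 * (p + 1))) $ (m - 1))"
      by (simp only: fps_add_nth fps_X_mult_nth)
    also have "\<dots> = (?I ^ (p + 1)) $ p"
      using less.prems p by (simp only: bit_fps_even_power_nth) simp
    also have "\<dots> = 0" using less p by simp
    finally show ?thesis .
  qed
qed

text \<open>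
  This is the passage from a generating-function symmetry to the Adem relations. With \<open>v = t + t\<^sup>2\<close>,
  so that \<open>dv = dt\<close> modulo 2, the coefficient \<open>c j\<close> of \<open>v\<^sup>j\<close> is the residue of
  \<open>1 / v ^ (j + 1)\<close> times the series. Taken on the other expression the same residue is the coefficient of
  \<open>t ^ (2 k - i)\<close> in \<open>(1 + t) ^ (k - j - 1)\<close>, the Adem binomial.
\<close>

lemma residue_inversion:
  fixes c :: "nat \<Rightarrow> bit"
  assumes "i + j = n" "i > 2 * j" and c0: "\<And>k. n < 2 * k \<Longrightarrow> c k = 0"
    and eq: "(\<Sum>k\<le>n. fps_const (c k) * (fps_X ^ k * (1 + fps_X) ^ k)) =
             (\<Sum>k\<le>n. fps_const (c k) * (fps_X ^ (n - 2 * k) * (1 + fps_X) ^ k))"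
  shows "c j = (\<Sum>k | i \<le> 2 * k \<and> k \<le> n. of_nat ((k - j - 1) choose (2 * k - i)) * c k)"
proof -
  define I where "I = inverse (1 + fps_X :: bit fps)"
  \<comment> \<open>The residue of \<open>f dv / v ^ (j + 1)\<close>, where \<open>v ^ (j + 1) = t ^ (j + 1) (1 + t) ^ (j + 1)\<close>.\<close>
  define L where "L = (\<lambda>f :: bit fps. (f * I ^ (j + 1)) $ j)"
  have inv: "(1 + fps_X) * I = 1"
    unfolding I_def by (rule inverse_mult_eq_1') simp
  have lin: "L (\<Sum>k\<le>n. fps_const (c k) * g k) = (\<Sum>k\<le>n. c k * L (g k))" for g
    by (simp add: L_def sum_distrib_right fps_sum_nth mult.assoc)
  have cancel: "(1 + fps_X) ^ k * I ^ (k + m) = I ^ m" "(1 + fps_X) ^ (k + m) * I ^ k = (1 + fps_X) ^ m" for k m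
  proof -
    have "(1 + fps_X) ^ k * I ^ (k + m) = ((1 + fps_X) * I) ^ k * I ^ m"
      "(1 + fps_X) ^ (k + m) * I ^ k = ((1 + fps_X) * I) ^ k * (1 + fps_X) ^ m"
      by (simp_all only: power_add power_mult_distrib mult.assoc mult.commute mult.left_commute)
    then show "(1 + fps_X) ^ k * I ^ (k + m) = I ^ m" "(1 + fps_X) ^ (k + m) * I ^ k = (1 + fps_X) ^ m"
      by (simp_all only: inv power_one mult_1_left)
  qed
  have left: "L (fps_X ^ k * (1 + fps_X) ^ k) = of_bool (k = j)" for k
  proof (cases "k \<le> j")
    case True
    have "(1 + fps_X) ^ k * I ^ (j + 1) = I ^ ((j - k) + 1)"
      using cancel(1)[of k "(j - k) + 1"] True by simp
    then have "L (fps_X ^ k * (1 + fps_X) ^ k) = (I ^ ((j - k) + 1)) $ (j - k)"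
      using True by (simp only: L_def mult.assoc fps_X_power_mult_nth) simp
    also have "\<dots> = of_bool (k = j)"
      using inverse_one_plus_X_power_diagonal[of "j - k"] True
      by (cases "k = j") (auto simp: I_def)
    finally show ?thesis .
  next
    case False
    then show ?thesis by (simp add: L_def mult.assoc fps_X_power_mult_nth)
  qed
  have right: "c k * L (fps_X ^ (n - 2 * k) * (1 + fps_X) ^ k) =
      (if i \<le> 2 * k then of_nat ((k - j - 1) choose (2 * k - i)) * c k else 0)" for k
  proof (cases "i \<le> 2 * k \<and> 2 * k \<le> n")
    case True
    have "(1 + fps_X) ^ k * I ^ (j + 1) = (1 + fps_X) ^ (k - j - 1)"
      using cancel(2)[of "j + 1" "k - j - 1"] True assms by simp
    moreover have "j - (n - 2 * k) = 2 * k - i" "n - 2 * k \<le> j" using True assms by auto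
    ultimately have "L (fps_X ^ (n - 2 * k) * (1 + fps_X) ^ k) = of_nat ((k - j - 1) choose (2 * k - i))"
      by (simp only: L_def mult.assoc fps_X_power_mult_nth) (simp add: one_plus_X_power_nth)
    then show ?thesis using True by simp
  next
    case False
    then show ?thesis using assms c0[of k]
      by (auto simp: L_def mult.assoc fps_X_power_mult_nth)
  qed
  have "c j = (\<Sum>k\<le>n. c k * of_bool (k = j))"
  proof -
    have "(\<Sum>k\<le>n. c k * of_bool (k = j)) = (\<Sum>k\<le>n. if k = j then c k else 0)"
      by (rule sum.cong) auto
    also have "\<dots> = c j"
      by (subst sum.delta) (use assms in auto)
    finally show ?thesis by (rule sym)
  qed
  also have "\<dots> = (\<Sum>k\<le>n. c k * L (fps_X ^ (n - 2 * k) * (1 + fps_X) ^ k))"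
    using arg_cong[OF eq, of L] by (simp only: lin left)
  also have "\<dots> = (\<Sum>k\<le>n. if i \<le> 2 * k then of_nat ((k - j - 1) choose (2 * k - i)) * c k else 0)"
    by (simp only: right)
  also have "\<dots> = (\<Sum>k | i \<le> 2 * k \<and> k \<le> n. of_nat ((k - j - 1) choose (2 * k - i)) * c k)"
    by (rule sum.mono_neutral_cong_right) auto
  finally show ?thesis .
qed

section \<open>Adem relations from a symmetric generating function\<close>

text \<open>
  For \<open>A = \<Sum> a\<^sub>m z\<^sup>m\<close> with \<open>Q\<^sup>2\<^sup>m u = a\<^sub>m u\<^sup>m\<^sup>+\<^sup>1\<close>, the coefficient of \<open>z\<^sup>m\<close> in \<open>A\<^sup>N\<close> is that of
  \<open>Q\<^sup>2\<^sup>m\<close> on \<open>u\<^sup>N\<close>. The Adem relations below are those for \<open>Q\<^sup>2\<^sup>i Q\<^sup>2\<^sup>j u\<^sup>N\<close>; the indices and the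
  binomial coefficients have been halved, which is harmless modulo 2.
\<close>

definition adem_relations :: "bit fps \<Rightarrow> nat \<Rightarrow> bool" where
  "adem_relations A N \<longleftrightarrow> (\<forall>i j. i > 2 * j \<longrightarrow>
     (A ^ N) $ j * (A ^ (N + j)) $ i =
     (\<Sum>k | i \<le> 2 * k \<and> k \<le> i + j.
        of_nat ((k - j - 1) choose (2 * k - i)) * ((A ^ N) $ k * (A ^ (N + k)) $ (i + j - k))))"

text \<open>
  Two-variable series are power series in \<open>z\<close> whose coefficients are power series in \<open>t\<close>. The name
  \<open>lift f\<close> stands for \<open>f(z)\<close>.
\<close>

definition lift :: "bit fps \<Rightarrow> bit fps fps" where
  "lift f = Abs_fps (\<lambda>n. fps_const (f $ n))"

lemma lift_nth [simp]: "lift f $ n = fps_const (f $ n)"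
  by (simp add: lift_def)

lemma fps_const_sum: "fps_const (sum f S) = (\<Sum>x\<in>S. fps_const (f x))" for f :: "_ \<Rightarrow> 'a::comm_ring_1"
  by (induction S rule: infinite_finite_induct) (auto simp flip: fps_const_add)

lemma lift_add: "lift (f + g) = lift f + lift g"
  by (rule fps_ext) simp

lemma lift_mult: "lift (f * g) = lift f * lift g"
  by (rule fps_ext) (simp only: lift_nth fps_mult_nth fps_const_sum fps_const_mult)

lemma lift_1: "lift 1 = 1"
  by (rule fps_ext) simp

lemma lift_X: "lift fps_X = fps_X"
  by (rule fps_ext) (simp add: fps_X_def)

lemma lift_power: "lift (f ^ n) = lift f ^ n"
  by (induction n) (simp_all add: lift_1 lift_mult)

lemma mult_compose_nth:
  fixes f g w :: "'a::idom fps"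
  assumes "w $ 0 = 0"
  shows "(f * (g oo w)) $ n = (\<Sum>j\<le>n. g $ j * (f * w ^ j) $ n)"
proof -
  have "(f * (g oo w)) $ n = (\<Sum>i\<le>n. f $ i * (\<Sum>j\<le>n. g $ j * (w ^ j) $ (n - i)))"
    unfolding fps_mult_nth atLeast0AtMost
  proof (rule sum.cong)
    fix i assume "i \<in> {..n}"
    have "(g oo w) $ (n - i) = (\<Sum>j\<le>n. g $ j * (w ^ j) $ (n - i))"
      unfolding fps_compose_nth atLeast0AtMost
      by (rule sum.mono_neutral_left)
         (use startsby_zero_power_prefix[OF assms] in \<open>auto simp: not_le\<close>)
    then show "f $ i * (g oo w) $ (n - i) = f $ i * (\<Sum>j\<le>n. g $ j * (w ^ j) $ (n - i))"
      by simp
  qed simp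
  also have "\<dots> = (\<Sum>i\<le>n. \<Sum>j\<le>n. g $ j * (f $ i * (w ^ j) $ (n - i)))"
    by (simp add: sum_distrib_left mult_ac)
  also have "\<dots> = (\<Sum>j\<le>n. \<Sum>i\<le>n. g $ j * (f $ i * (w ^ j) $ (n - i)))"
    by (rule sum.swap)
  also have "\<dots> = (\<Sum>j\<le>n. g $ j * (f * w ^ j) $ n)"
    by (simp add: fps_mult_nth atLeast0AtMost sum_distrib_left)
  finally show ?thesis .
qed

abbreviation T :: "bit fps fps" where "T \<equiv> fps_const fps_X"
abbreviation Z :: "bit fps fps" where "Z \<equiv> fps_X"

text \<open>
  These are \<open>A(t z)\<close> and, when \<open>A\<close> has no constant term, \<open>A(t z) / t\<close>. The second is defined through
  its coefficients because \<open>t\<close> is not invertible.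
\<close>

definition scaled :: "bit fps \<Rightarrow> bit fps fps" where
  "scaled A = Abs_fps (\<lambda>n. fps_const (A $ n) * fps_X ^ n)"

definition scaled_quotient :: "bit fps \<Rightarrow> bit fps fps" where
  "scaled_quotient A = Abs_fps (\<lambda>n. fps_const (A $ n) * fps_X ^ (n - 1))"

lemma scaled_conv_compose: "scaled A = lift A oo (T * Z)"
  unfolding fps_compose_linear
  by (rule fps_ext) (simp add: scaled_def fps_const_power mult.commute)

lemma scaled_mult: "scaled (f * g) = scaled f * scaled g"
  by (simp add: scaled_conv_compose lift_mult fps_compose_mult_distrib)

lemma scaled_power: "scaled A ^ n = scaled (A ^ n)"
  by (simp add: scaled_conv_compose lift_power fps_compose_power)

lemma T_mult_scaled_quotient:
  assumes "A $ 0 = 0"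
  shows "T * scaled_quotient A = scaled A"
proof (rule fps_ext)
  fix n show "(T * scaled_quotient A) $ n = scaled A $ n"
    using assms by (cases n) (auto simp: scaled_def scaled_quotient_def mult_ac)
qed

text \<open>
  The two sides are exchanged by interchanging \<open>z\<close> and \<open>t z\<close>: with \<open>s\<close> and \<open>t\<close> for these, the condition
  says that \<open>A(s) A(t (s + t) A(s) / s)\<close> is symmetric in \<open>s\<close> and \<open>t\<close>. The terms of this
  product are \<open>s ^ (i - j) t ^ j (s + t) ^ j\<close> times the coefficient of \<open>Q\<^sup>2\<^sup>i Q\<^sup>2\<^sup>j u\<close>.
\<close>

definition symmetric_series :: "bit fps \<Rightarrow> bool" where
  "symmetric_series A \<longleftrightarrow>
     lift A * (lift A oo ((T + T\<^sup>2) * Z * lift A)) =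
     scaled A * (lift A oo ((1 + T) * Z * scaled_quotient A))"

lemma T_power: "T ^ n = fps_const (fps_X ^ n)"
  by (induction n) simp_all

lemma power_nth_eq_0: "A $ 0 = 0 \<Longrightarrow> m < N \<Longrightarrow> (A ^ N) $ m = 0" for A :: "bit fps"
  using startsby_zero_power_prefix[of A N] by simp

text \<open>
  The coefficient of \<open>z\<^sup>n\<close> in the \<open>N\<close>-th power of the symmetry condition. The
  \<open>N\<close>-th power takes care of \<open>u\<^sup>N\<close>, so that the relations hold on all monomials
  once the condition holds for the generator.
\<close>

lemma symmetric_series_coeff:
  assumes sym: "symmetric_series A" and A0: "A $ 0 = 0"
  defines "c \<equiv> \<lambda>N n k. (A ^ N) $ k * (A ^ (N + k)) $ (n - k)"
  shows "(\<Sum>k\<le>n. fps_const (c N n k) * (fps_X ^ k * (1 + fps_X) ^ k)) =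
         (\<Sum>k\<le>n. fps_const (c N n k) * (fps_X ^ (n - 2 * k) * (1 + fps_X) ^ k))"
proof -
  define B where "B = lift A"
  define D where "D = scaled_quotient A"
  define W where "W = (T + T\<^sup>2) * Z * B"
  define W' where "W' = (1 + T) * Z * D"
  have W0: "W $ 0 = 0" "W' $ 0 = 0" by (simp_all add: W_def W'_def)
  have BN: "B ^ N = lift (A ^ N)" for N by (simp add: B_def lift_power)
  have left: "(B ^ N * (B ^ N oo W)) $ n = (\<Sum>k\<le>n. fps_const (c N n k) * (fps_X ^ k * (1 + fps_X) ^ k))"
    unfolding mult_compose_nth[OF W0(1)]
  proof (rule sum.cong)
    fix k assume k: "k \<in> {..n}"
    have "W ^ k = fps_const ((fps_X + fps_X\<^sup>2) ^ k) * (Z ^ k * B ^ k)"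
    proof -
      have "W = fps_const (fps_X + fps_X\<^sup>2) * (Z * B)"
        by (simp add: W_def mult.assoc T_power)
      then show ?thesis by (simp only: power_mult_distrib fps_const_power)
    qed
    then have "B ^ N * W ^ k = fps_const ((fps_X + fps_X\<^sup>2) ^ k) * (Z ^ k * B ^ (N + k))"
      by (simp only: power_add mult_ac)
    then have "(B ^ N * W ^ k) $ n = (fps_X + fps_X\<^sup>2) ^ k * fps_const ((A ^ (N + k)) $ (n - k))"
      using k by (simp only: fps_mult_left_const_nth fps_X_power_mult_nth BN lift_nth) simp
    moreover have "(fps_X + fps_X\<^sup>2) ^ k = (fps_X ^ k * (1 + fps_X) ^ k :: bit fps)"
      by (simp add: power_mult_distrib[symmetric] algebra_simps power2_eq_square)
    ultimately show "(B ^ N) $ k * (B ^ N * W ^ k) $ n = fps_const (c N n k) * (fps_X ^ k * (1 + fps_X) ^ k)"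
      by (simp only: BN lift_nth c_def fps_const_mult[symmetric] mult_ac)
  qed simp
  have right: "(scaled A ^ N * (B ^ N oo W')) $ n = (\<Sum>k\<le>n. fps_const (c N n k) * (fps_X ^ (n - 2 * k) * (1 + fps_X) ^ k))"
    unfolding mult_compose_nth[OF W0(2)]
  proof (rule sum.cong)
    fix k assume k: "k \<in> {..n}"
    have "W' ^ k = fps_const ((1 + fps_X) ^ k) * (Z ^ k * D ^ k)"
    proof -
      have "W' = fps_const (1 + fps_X) * (Z * D)"
        by (simp add: W'_def mult.assoc flip: fps_const_add)
      then show ?thesis by (simp only: power_mult_distrib fps_const_power)
    qed
    then have "scaled A ^ N * W' ^ k = fps_const ((1 + fps_X) ^ k) * (Z ^ k * (scaled A ^ N * D ^ k))"
      by (simp only: mult_ac)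
    then have 1: "(scaled A ^ N * W' ^ k) $ n = (1 + fps_X) ^ k * (scaled A ^ N * D ^ k) $ (n - k)"
      using k by (simp only: fps_mult_left_const_nth fps_X_power_mult_nth) simp
    have "fps_const (fps_X ^ k) * (scaled A ^ N * D ^ k) = scaled A ^ N * (T * D) ^ k"
      by (simp only: T_power[symmetric] power_mult_distrib mult_ac)
    also have "\<dots> = scaled (A ^ (N + k))"
      by (simp only: D_def T_mult_scaled_quotient[of A, OF A0] power_add scaled_power scaled_mult)
    finally have "fps_X ^ k * (scaled A ^ N * D ^ k) $ (n - k) = scaled (A ^ (N + k)) $ (n - k)"
      by (metis fps_mult_left_const_nth)
    then have 2: "fps_X ^ k * (scaled A ^ N * D ^ k) $ (n - k) = fps_const ((A ^ (N + k)) $ (n - k)) * fps_X ^ (n - k)"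
      by (simp add: scaled_def)
    \<comment> \<open>For \<open>2 * k > n\<close> the exponent is truncated, but then the coefficient of \<open>A ^ (N + k)\<close> is 0.\<close>
    have 3: "(scaled A ^ N * D ^ k) $ (n - k) = fps_const ((A ^ (N + k)) $ (n - k)) * fps_X ^ (n - 2 * k)"
    proof (cases "2 * k \<le> n")
      case True
      then have "fps_X ^ (n - k) = (fps_X ^ k * fps_X ^ (n - 2 * k) :: bit fps)"
        by (simp flip: power_add)
      then have "fps_X ^ k * (scaled A ^ N * D ^ k) $ (n - k) =
          fps_X ^ k * (fps_const ((A ^ (N + k)) $ (n - k)) * fps_X ^ (n - 2 * k))"
        using 2 by (simp only: mult_ac)
      then show ?thesis by simp
    next
      case False
      then have "(A ^ (N + k)) $ (n - k) = 0" using k by (intro power_nth_eq_0 A0) auto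
      then show ?thesis using 2 by simp
    qed
    show "(B ^ N) $ k * (scaled A ^ N * W' ^ k) $ n = fps_const (c N n k) * (fps_X ^ (n - 2 * k) * (1 + fps_X) ^ k)"
      unfolding 1 3 c_def BN lift_nth fps_const_mult[symmetric] by (simp only: mult_ac)
  qed simp
  have "B * (B oo W) = scaled A * (B oo W')"
    using sym by (simp add: symmetric_series_def B_def D_def W_def W'_def)
  then have "(B * (B oo W)) ^ N = (scaled A * (B oo W')) ^ N" by simp
  then have "B ^ N * (B ^ N oo W) = scaled A ^ N * (B ^ N oo W')"
    by (simp add: power_mult_distrib fps_compose_power W0)
  then show ?thesis using left right by simp
qed

lemma symmetric_series_imp_adem_relations:
  assumes sym: "symmetric_series A" and A0: "A $ 0 = 0"
  shows "adem_relations A N"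
  unfolding adem_relations_def
proof (intro allI impI)
  fix i j :: nat
  assume ij: "i > 2 * j"
  define n where "n = i + j"
  define c where "c = (\<lambda>k. (A ^ N) $ k * (A ^ (N + k)) $ (n - k))"
  have "c j = (\<Sum>k | i \<le> 2 * k \<and> k \<le> n. of_nat ((k - j - 1) choose (2 * k - i)) * c k)"
  proof (rule residue_inversion)
    show "c k = 0" if "n < 2 * k" for k
      using power_nth_eq_0[OF A0, of "n - k" "N + k"] that by (simp add: c_def)
    show "(\<Sum>k\<le>n. fps_const (c k) * (fps_X ^ k * (1 + fps_X) ^ k)) =
          (\<Sum>k\<le>n. fps_const (c k) * (fps_X ^ (n - 2 * k) * (1 + fps_X) ^ k))"
      unfolding c_def by (rule symmetric_series_coeff[OF sym A0])
  qed (use ij n_def in auto)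
  then show "(A ^ N) $ j * (A ^ (N + j)) $ i =
     (\<Sum>k | i \<le> 2 * k \<and> k \<le> i + j.
        of_nat ((k - j - 1) choose (2 * k - i)) * ((A ^ N) $ k * (A ^ (N + k)) $ (i + j - k)))"
    by (simp add: c_def n_def)
qed

section \<open>Four symmetric series\<close>

definition all_series :: "bit fps" where
  "all_series = Abs_fps (\<lambda>n. of_bool (n \<ge> 1))"

definition odd_series :: "bit fps" where
  "odd_series = Abs_fps (\<lambda>n. of_bool (odd n))"

definition artin_schreier_series :: "bit fps" where
  "artin_schreier_series = Abs_fps (\<lambda>n. of_bool (\<exists>k. n = 2 ^ k))"

text \<open>
  If \<open>y\<close> is the Artin-Schreier series, \<open>y\<^sup>2 + y = z\<close>, this is \<open>y\<^sup>2 / z = z + z\<^sup>3 + z\<^sup>7 + \<dots>\<close>. Here \<open>y / z\<close> is the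
  reduction modulo 2 of the generating function of the Catalan numbers.
\<close>

definition catalan_series :: "bit fps" where
  "catalan_series = fps_shift 1 (artin_schreier_series ^ 2)"

lemma two_eq_0: "(2 :: bit fps fps) = 0"
  using bit_fps2_add_self[of 1] by simp

lemma all_series_eq: "all_series * (1 + fps_X) = fps_X"
  by (rule fps_ext) (simp add: all_series_def distrib_left fps_X_mult_right_nth Suc_le_eq)

lemma odd_series_eq: "odd_series * (1 + fps_X\<^sup>2) = fps_X"
proof (rule fps_ext)
  fix n show "(odd_series * (1 + fps_X\<^sup>2)) $ n = fps_X $ n"
    by (cases "n = 0"; cases "n = 1") (auto simp: odd_series_def distrib_left fps_X_power_mult_right_nth)
qed

lemma artin_schreier_eq: "artin_schreier_series\<^sup>2 + artin_schreier_series = fps_X"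
proof (rule fps_ext)
  fix n :: nat
  consider "n = 0" | "n = 1" | "n > 1" "odd n" | "n > 0" "even n" by fastforce
  then show "(artin_schreier_series\<^sup>2 + artin_schreier_series) $ n = fps_X $ n"
  proof cases
    case 3
    then have "\<nexists>k. n = 2 ^ k" by auto
    with 3 show ?thesis by (simp add: bit_fps_square_nth artin_schreier_series_def)
  next
    case 4
    then obtain m where m: "n = 2 * m" "m > 0" by auto
    have "(\<exists>k. n = 2 ^ k) \<longleftrightarrow> (\<exists>k. m = 2 ^ k)"
    proof
      assume "\<exists>k. n = 2 ^ k"
      then obtain k where "n = 2 ^ k" by blast
      with m show "\<exists>k. m = 2 ^ k" by (cases k) auto
    next
      assume "\<exists>k. m = 2 ^ k"
      then show "\<exists>k. n = 2 ^ k" using m by (metis power_Suc)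
    qed
    with m show ?thesis by (simp add: bit_fps_square_nth artin_schreier_series_def)
  qed (auto simp: bit_fps_square_nth artin_schreier_series_def intro: exI[of _ 0])
qed

lemma catalan_series_eq: "fps_X * catalan_series = artin_schreier_series\<^sup>2"
  by (rule fps_ext) (auto simp: catalan_series_def bit_fps_square_nth artin_schreier_series_def)

lemma series_0 [simp]:
  "all_series $ 0 = 0" "odd_series $ 0 = 0" "catalan_series $ 0 = 0" "artin_schreier_series $ 0 = 0"
  by (auto simp: all_series_def odd_series_def catalan_series_def artin_schreier_series_def bit_fps_square_nth)

lemma symmetric_seriesI:
  assumes "A $ 0 = 0"
    and "\<And>b s d w w' r r'. \<lbrakk>w = (T + T\<^sup>2) * Z * b; w' = (1 + T) * Z * d; T * d = s; w $ 0 = 0; w' $ 0 = 0;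
      b = lift A; s = lift A oo (T * Z); r = lift A oo w; r' = lift A oo w'\<rbrakk> \<Longrightarrow> b * r = s * r'"
  shows "symmetric_series A"
  unfolding symmetric_series_def
  by (rule assms(2)[where d = "scaled_quotient A"]) (simp_all add: T_mult_scaled_quotient scaled_conv_compose[symmetric] assms(1))

lemma fps_neq_0_if_nth_0: "f $ 0 \<noteq> 0 \<Longrightarrow> f \<noteq> 0"
  by auto

lemma T_neq_0: "T \<noteq> 0"
  by (rule fps_neq_0_if_nth_0) simp

text \<open>
  Here, in \<open>odd_identity\<close> and in \<open>catalan_identity\<close> the letters stand for the series in the symmetry
  condition: \<open>b = A(z)\<close>,
  \<open>s = A(t z)\<close>, \<open>d = s / t\<close>, and \<open>r\<close>, \<open>r'\<close> are the values of \<open>A\<close> at the arguments \<open>w\<close>, \<open>w'\<close>. An algebraic equation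
  for \<open>A\<close> gives one for each of them, and what is to be shown becomes a polynomial identity modulo 2;
  the terms with a factor 2 are written out where the two sides differ by them.
  For \<open>A = z / (1 + z)\<close> both products are \<open>(t + t\<^sup>2) z\<^sup>3\<close> divided by the same polynomial.
\<close>

lemma all_identity:
  fixes t z b s d w w' r r' :: "bit fps fps"
  assumes "w = (t + t\<^sup>2) * z * b" "w' = (1 + t) * z * d" "t * d = s" "t \<noteq> 0"
    and "b * (1 + z) = z" "s * (1 + t * z) = t * z" "r * (1 + w) = w" "r' * (1 + w') = w'"
    and "(1 + z) * (1 + z + (t + t\<^sup>2) * z\<^sup>2) \<noteq> 0"
  shows "b * r = s * r'"
proof -
  have d: "d * (1 + t * z) = z"
  proof -
    have "t * (d * (1 + t * z)) = t * z" using assms(3,6) by (simp add: mult.assoc[symmetric])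
    then show ?thesis using assms(4) by simp
  qed
  have "b * r * ((1 + z) * (1 + z + (t + t\<^sup>2) * z\<^sup>2)) = (t + t\<^sup>2) * z ^ 3"
  proof -
    have "(1 + z) * (r * (1 + w)) = r * ((1 + z) + (t + t\<^sup>2) * z * (b * (1 + z)))"
      unfolding assms(1) by algebra
    moreover have "(1 + z) * w = (t + t\<^sup>2) * z * (b * (1 + z))"
      unfolding assms(1) by algebra
    ultimately have "r * ((1 + z) + (t + t\<^sup>2) * z * z) = (t + t\<^sup>2) * z * z"
      using assms(5,7) by simp
    moreover have "b * r * ((1 + z) * (1 + z + (t + t\<^sup>2) * z\<^sup>2)) = (b * (1 + z)) * (r * ((1 + z) + (t + t\<^sup>2) * z * z))"
      by algebra
    ultimately show ?thesis unfolding assms(5) by algebra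
  qed
  moreover have "s * r' * ((1 + t * z) * (1 + t * z + (1 + t) * z\<^sup>2)) = (t + t\<^sup>2) * z ^ 3"
  proof -
    have "(1 + t * z) * (r' * (1 + w')) = r' * ((1 + t * z) + (1 + t) * z * (d * (1 + t * z)))"
      unfolding assms(2) by algebra
    moreover have "(1 + t * z) * w' = (1 + t) * z * (d * (1 + t * z))"
      unfolding assms(2) by algebra
    ultimately have "r' * ((1 + t * z) + (1 + t) * z * z) = (1 + t) * z * z"
      using d assms(8) by simp
    moreover have "s * r' * ((1 + t * z) * (1 + t * z + (1 + t) * z\<^sup>2)) = (s * (1 + t * z)) * (r' * ((1 + t * z) + (1 + t) * z * z))"
      by algebra
    ultimately show ?thesis unfolding assms(6) by algebra
  qed
  moreover have "(1 + t * z) * (1 + t * z + (1 + t) * z\<^sup>2) + 2 * z  = (1 + z) * (1 + z + (t + t\<^sup>2) * z\<^sup>2) + 2 * (t * z)"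
    by algebra
  ultimately have "b * r * ((1 + z) * (1 + z + (t + t\<^sup>2) * z\<^sup>2)) = s * r' * ((1 + z) * (1 + z + (t + t\<^sup>2) * z\<^sup>2))"
    unfolding two_eq_0 mult_zero_left add_0_right by simp
  then show ?thesis using assms(9) by simp
qed

lemma all_series_compose:
  assumes "w $ 0 = 0"
  shows "(lift all_series oo w) * (1 + w) = w"
proof -
  have "lift all_series * (1 + Z) = Z"
    using arg_cong[OF all_series_eq, of lift] by (simp add: lift_mult lift_add lift_1 lift_X)
  then have "(lift all_series * (1 + Z)) oo w = Z oo w" by simp
  then show ?thesis using assms by (simp add: fps_compose_mult_distrib fps_compose_add_distrib)
qed

lemma symmetric_all_series: "symmetric_series all_series"
proof (rule symmetric_seriesI)
  fix b s d w w' r r'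
  assume *: "w = (T + T\<^sup>2) * Z * b" "w' = (1 + T) * Z * d" "T * d = s" "w $ 0 = 0" "w' $ 0 = 0"
    "b = lift all_series" "s = lift all_series oo (T * Z)" "r = lift all_series oo w" "r' = lift all_series oo w'"
  show "b * r = s * r'"
  proof (rule all_identity[OF *(1-3) T_neq_0])
    show "(1 + Z) * (1 + Z + (T + T\<^sup>2) * Z\<^sup>2) \<noteq> 0"
      by (rule fps_neq_0_if_nth_0) simp
  qed (use all_series_compose[of Z] all_series_compose[of "T * Z"] all_series_compose[of w] all_series_compose[of w'] *(4-)
       in simp_all)
qed simp

lemma odd_series_compose:
  assumes "w $ 0 = 0"
  shows "(lift odd_series oo w) * (1 + w\<^sup>2) = w"
proof -
  have "lift odd_series * (1 + Z\<^sup>2) = Z"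
    using arg_cong[OF odd_series_eq, of lift] by (simp add: lift_mult lift_add lift_1 lift_X lift_power)
  then have "(lift odd_series * (1 + Z\<^sup>2)) oo w = Z oo w" by simp
  then show ?thesis using assms
    by (simp add: fps_compose_mult_distrib fps_compose_add_distrib fps_compose_power[symmetric])
qed

text \<open>
  Both products are again \<open>(t + t\<^sup>2) z\<^sup>3\<close> over one polynomial, now a square:
  \<open>(1 + z\<^sup>2 + (t + t\<^sup>2) z\<^sup>2)\<^sup>2\<close>, which equals \<open>(1 + t\<^sup>2 z\<^sup>2 + (1 + t) z\<^sup>2)\<^sup>2\<close> modulo 2.
\<close>

lemma odd_identity:
  fixes t z b s d w w' r r' :: "bit fps fps"
  assumes "w = (t + t\<^sup>2) * z * b" "w' = (1 + t) * z * d" "t * d = s" "t \<noteq> 0"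
    and "b * (1 + z\<^sup>2) = z" "s * (1 + (t * z)\<^sup>2) = t * z" "r * (1 + w\<^sup>2) = w" "r' * (1 + w'\<^sup>2) = w'"
    and "(1 + z\<^sup>2)\<^sup>2 + ((t + t\<^sup>2) * z * z)\<^sup>2 \<noteq> 0"
  shows "b * r = s * r'"
proof -
  have d: "d * (1 + (t * z)\<^sup>2) = z"
  proof -
    have "t * (d * (1 + (t * z)\<^sup>2)) = t * z" using assms(3,6) by (simp add: mult.assoc[symmetric])
    then show ?thesis using assms(4) by simp
  qed
  have "b * r * ((1 + z\<^sup>2)\<^sup>2 + ((t + t\<^sup>2) * z * z)\<^sup>2) = (t + t\<^sup>2) * z ^ 3"
  proof -
    have "(1 + z\<^sup>2)\<^sup>2 * (r * (1 + w\<^sup>2)) = r * ((1 + z\<^sup>2)\<^sup>2 + ((t + t\<^sup>2) * z * (b * (1 + z\<^sup>2)))\<^sup>2)"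
      unfolding assms(1) by algebra
    moreover have "(1 + z\<^sup>2)\<^sup>2 * w = (1 + z\<^sup>2) * ((t + t\<^sup>2) * z * (b * (1 + z\<^sup>2)))"
      unfolding assms(1) by algebra
    ultimately have "r * ((1 + z\<^sup>2)\<^sup>2 + ((t + t\<^sup>2) * z * z)\<^sup>2) = (1 + z\<^sup>2) * ((t + t\<^sup>2) * z * z)"
      using assms(5,7) by simp
    then have "b * r * ((1 + z\<^sup>2)\<^sup>2 + ((t + t\<^sup>2) * z * z)\<^sup>2) = (b * (1 + z\<^sup>2)) * ((t + t\<^sup>2) * z * z)"
      by (simp only: mult.assoc)
    then show ?thesis unfolding assms(5) by algebra
  qed
  moreover have "s * r' * ((1 + (t * z)\<^sup>2)\<^sup>2 + ((1 + t) * z * z)\<^sup>2) = (t + t\<^sup>2) * z ^ 3"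
  proof -
    have "(1 + (t * z)\<^sup>2)\<^sup>2 * (r' * (1 + w'\<^sup>2)) = r' * ((1 + (t * z)\<^sup>2)\<^sup>2 + ((1 + t) * z * (d * (1 + (t * z)\<^sup>2)))\<^sup>2)"
      unfolding assms(2) by algebra
    moreover have "(1 + (t * z)\<^sup>2)\<^sup>2 * w' = (1 + (t * z)\<^sup>2) * ((1 + t) * z * (d * (1 + (t * z)\<^sup>2)))"
      unfolding assms(2) by algebra
    ultimately have "r' * ((1 + (t * z)\<^sup>2)\<^sup>2 + ((1 + t) * z * z)\<^sup>2) = (1 + (t * z)\<^sup>2) * ((1 + t) * z * z)"
      using d assms(8) by simp
    then have "s * r' * ((1 + (t * z)\<^sup>2)\<^sup>2 + ((1 + t) * z * z)\<^sup>2) = (s * (1 + (t * z)\<^sup>2)) * ((1 + t) * z * z)"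
      by (simp only: mult.assoc)
    then show ?thesis unfolding assms(6) by algebra
  qed
  moreover have "(1 + (t * z)\<^sup>2)\<^sup>2 + ((1 + t) * z * z)\<^sup>2 + 2 * (z\<^sup>2 + t ^ 3 * z ^ 4) =
      (1 + z\<^sup>2)\<^sup>2 + ((t + t\<^sup>2) * z * z)\<^sup>2 + 2 * (t\<^sup>2 * z\<^sup>2 + t * z ^ 4)"
    by algebra
  ultimately have "b * r * ((1 + z\<^sup>2)\<^sup>2 + ((t + t\<^sup>2) * z * z)\<^sup>2) = s * r' * ((1 + z\<^sup>2)\<^sup>2 + ((t + t\<^sup>2) * z * z)\<^sup>2)"
    unfolding two_eq_0 mult_zero_left add_0_right by simp
  then show ?thesis using assms(9) by simp
qed

lemma symmetric_odd_series: "symmetric_series odd_series"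
proof (rule symmetric_seriesI)
  fix b s d w w' r r'
  assume *: "w = (T + T\<^sup>2) * Z * b" "w' = (1 + T) * Z * d" "T * d = s" "w $ 0 = 0" "w' $ 0 = 0"
    "b = lift odd_series" "s = lift odd_series oo (T * Z)" "r = lift odd_series oo w" "r' = lift odd_series oo w'"
  show "b * r = s * r'"
  proof (rule odd_identity[OF *(1-3) T_neq_0])
    show "(1 + Z\<^sup>2)\<^sup>2 + ((T + T\<^sup>2) * Z * Z)\<^sup>2 \<noteq> 0"
      by (rule fps_neq_0_if_nth_0) (simp add: fps_power_zeroth)
  qed (use odd_series_compose[of Z] odd_series_compose[of "T * Z"] odd_series_compose[of w] odd_series_compose[of w'] *(4-)
       in simp_all)
qed simp

lemma symmetric_X: "symmetric_series fps_X"
proof (rule symmetric_seriesI)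
  fix b s d w w' r r'
  assume *: "w = (T + T\<^sup>2) * Z * b" "w' = (1 + T) * Z * d" "T * d = s" "w $ 0 = 0" "w' $ 0 = 0"
    "b = lift fps_X" "s = lift fps_X oo (T * Z)" "r = lift fps_X oo w" "r' = lift fps_X oo w'"
  then have "b = Z" "s = T * Z" "r = w" "r' = w'" by (simp_all add: lift_X)
  moreover from this * T_neq_0 have "d = Z" by simp
  moreover have "z * ((t + t\<^sup>2) * z * z) = t * z * ((1 + t) * z * z)" for t z :: "bit fps fps"
    by algebra
  ultimately show "b * r = s * r'" using *(1,2) by metis
qed simp

lemma artin_schreier_compose:
  assumes "w $ 0 = 0"
  shows "(lift artin_schreier_series oo w)\<^sup>2 + (lift artin_schreier_series oo w) = w"
proof -
  have "(lift artin_schreier_series)\<^sup>2 + lift artin_schreier_series = Z"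
    using arg_cong[OF artin_schreier_eq, of lift] by (simp add: lift_add lift_X lift_power)
  then have "((lift artin_schreier_series)\<^sup>2 + lift artin_schreier_series) oo w = Z oo w" by simp
  then show ?thesis using assms
    by (simp add: fps_compose_add_distrib fps_compose_power[symmetric])
qed

lemma catalan_compose:
  assumes "w $ 0 = 0"
  shows "w * (lift catalan_series oo w) = (lift artin_schreier_series oo w)\<^sup>2"
proof -
  have "Z * lift catalan_series = (lift artin_schreier_series)\<^sup>2"
    using arg_cong[OF catalan_series_eq, of lift] by (simp add: lift_mult lift_X lift_power)
  then have "(Z * lift catalan_series) oo w = (lift artin_schreier_series)\<^sup>2 oo w" by simp
  then show ?thesis using assms
    by (simp add: fps_compose_mult_distrib fps_compose_power[symmetric])
qed

text \<open>
  Let \<open>y\<close>, \<open>y'\<close>, \<open>q\<close>, \<open>q'\<close> be the Artin-Schreier series at \<open>z\<close>, \<open>t z\<close>, \<open>w\<close>, \<open>w'\<close>. The solution of \<open>x\<^sup>2 + x = w\<close>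
  without constant term is unique, and additivity of squaring exhibits it: \<open>q = t y + y'\<close>. In
  the same way \<open>t q' = t y + y'\<close>. Both products in question, times \<open>(t + t\<^sup>2) z\<close>, are the square of this common value.
\<close>

lemma catalan_identity:
  fixes t z b s d w w' r r' y y' q q' :: "bit fps fps"
  assumes "w = (t + t\<^sup>2) * z * b" "w' = (1 + t) * z * d" "t * d = s"
    and y: "y\<^sup>2 + y = z" "y'\<^sup>2 + y' = t * z" "q\<^sup>2 + q = w" "q'\<^sup>2 + q' = w'"
    and b: "z * b = y\<^sup>2" "t * z * s = y'\<^sup>2" "w * r = q\<^sup>2" "w' * r' = q'\<^sup>2"
    and nz: "q + (t * y + y') + 1 \<noteq> 0" "t * q' + (t * y + y') + t \<noteq> 0" "(t + t\<^sup>2) * z \<noteq> 0"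
  shows "b * r = s * r'"
proof -
  define e where "e = t * y + y'"
  have w: "w = (t + t\<^sup>2) * y\<^sup>2" using assms(1) b(1) by (simp only: mult.assoc)
  have w': "t\<^sup>2 * w' = (1 + t) * y'\<^sup>2"
  proof -
    have "t\<^sup>2 * w' = (1 + t) * (t * z * (t * d))" unfolding assms(2) by algebra
    then show ?thesis by (simp only: assms(3) b(2))
  qed
  have e1: "e\<^sup>2 + e = w"
  proof -
    have "e\<^sup>2 + e = t\<^sup>2 * y\<^sup>2 + t * y + (y'\<^sup>2 + y') + 2 * (t * y * y')" unfolding e_def by algebra
    also have "\<dots> = w + 2 * (t * y + t * y * y')" unfolding y(2) w y(1)[symmetric] by algebra
    finally show ?thesis by (simp only: two_eq_0 mult_zero_left add_0_right)
  qed
  have e2: "e\<^sup>2 + t * e = t\<^sup>2 * w'"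
  proof -
    have "e\<^sup>2 + t * e = t\<^sup>2 * (y\<^sup>2 + y) + t * y' + y'\<^sup>2 + 2 * (t * y * y')" unfolding e_def by algebra
    also have "\<dots> = t * (t * z) + t * y' + y'\<^sup>2 + 2 * (t * y * y')" unfolding y(1) by algebra
    also have "\<dots> = t\<^sup>2 * w' + 2 * (t * y' + t * y * y')" unfolding w' y(2)[symmetric] by algebra
    finally show ?thesis by (simp only: two_eq_0 mult_zero_left add_0_right)
  qed
  have "(q - e) * (q + e + 1) = 0"
  proof -
    have "(q - e) * (q + e + 1) = (q\<^sup>2 + q) - (e\<^sup>2 + e)" by algebra
    then show ?thesis by (simp only: y(3) e1 diff_self)
  qed
  then have q: "q = e" using nz(1) by (auto simp: e_def)
  have "(t * q' - e) * (t * q' + e + t) = 0"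
  proof -
    have "(t * q' - e) * (t * q' + e + t) = t\<^sup>2 * (q'\<^sup>2 + q') - (e\<^sup>2 + t * e)" by algebra
    then show ?thesis by (simp only: y(4) e2 diff_self)
  qed
  then have q': "t * q' = e" using nz(2) by (auto simp: e_def)
  have "(t + t\<^sup>2) * z * (b * r) = w * r" unfolding assms(1) by algebra
  also have "\<dots> = e\<^sup>2" by (simp only: b(3) q)
  also have "\<dots> = t\<^sup>2 * (w' * r')" unfolding q'[symmetric] b(4) by algebra
  also have "\<dots> = (t + t\<^sup>2) * z * (s * r')" unfolding assms(2) assms(3)[symmetric] by algebra
  finally show ?thesis using nz(3) by simp
qed

lemma symmetric_catalan_series: "symmetric_series catalan_series"
proof (rule symmetric_seriesI)
  fix b s d w w' r r'
  assume *: "w = (T + T\<^sup>2) * Z * b" "w' = (1 + T) * Z * d" "T * d = s" "w $ 0 = 0" "w' $ 0 = 0"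
    "b = lift catalan_series" "s = lift catalan_series oo (T * Z)" "r = lift catalan_series oo w" "r' = lift catalan_series oo w'"
  let ?y = "lift artin_schreier_series"
  have yc: "?y oo Z = ?y" "lift catalan_series oo Z = lift catalan_series" by simp_all
  show "b * r = s * r'"
  proof (rule catalan_identity[OF *(1-3), where y = ?y and y' = "?y oo (T * Z)" and q = "?y oo w" and q' = "?y oo w'"])
    show "(?y oo w) + (T * ?y + (?y oo (T * Z))) + 1 \<noteq> 0"
      by (rule fps_neq_0_if_nth_0) simp
    show "T * (?y oo w') + (T * ?y + (?y oo (T * Z))) + T \<noteq> 0"
      by (rule fps_neq_0_if_nth_0) simp
    show "(T + T\<^sup>2) * Z \<noteq> 0"
    proof -
      have "((T + T\<^sup>2) * Z) $ 1 = fps_X + fps_X\<^sup>2" by (simp add: T_power)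
      moreover have "(fps_X + fps_X\<^sup>2 :: bit fps) $ 1 = 1" by simp
      ultimately show ?thesis by (metis fps_zero_nth zero_neq_one)
    qed
  qed (use artin_schreier_compose[of Z] catalan_compose[of Z] artin_schreier_compose[of "T * Z"] catalan_compose[of "T * Z"]
        artin_schreier_compose[of w] catalan_compose[of w] artin_schreier_compose[of w'] catalan_compose[of w'] *(4-)
       in \<open>simp_all add: yc\<close>)
qed simp

section \<open>Uniqueness\<close>

lemma adem_relationsD:
  assumes "adem_relations A N" "i > 2 * j"
  shows "(A ^ N) $ j * (A ^ (N + j)) $ i =
     (\<Sum>k | i \<le> 2 * k \<and> k \<le> i + j.
        of_nat ((k - j - 1) choose (2 * k - i)) * ((A ^ N) $ k * (A ^ (N + k)) $ (i + j - k)))"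
  using assms by (simp add: adem_relations_def)

lemma fps_mult_nth_2: "(f * g) $ 2 = f $ 0 * g $ 2 + f $ 1 * g $ 1 + f $ 2 * g $ 0"
  for f g :: "'a::comm_ring_1 fps"
  by (simp add: fps_mult_nth numeral_2_eq_2 atLeastAtMostSuc_conv algebra_simps)

text \<open>
  Only the relations on the generator itself (\<open>N = 1\<close>) are assumed: they already force \<open>A\<close> to be one of
  the four series.
\<close>

locale adem_series =
  fixes A :: "bit fps"
  assumes A0: "A $ 0 = 0" and A1: "A $ 1 = 1" and adem: "adem_relations A 1"
begin

definition F :: "bit fps" where "F = fps_shift 1 A"

lemma F_nth: "F $ n = A $ Suc n"
  by (simp add: F_def)

lemma A_conv_F: "A = fps_X * F"
  by (rule fps_ext) (auto simp: F_nth A0)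

lemma power_eq_0: "m < N \<Longrightarrow> (A ^ N) $ m = 0"
  using power_nth_eq_0[OF A0] .

lemma power_nth: "m \<ge> N \<Longrightarrow> (A ^ N) $ m = (F ^ N) $ (m - N)"
  by (subst A_conv_F) (simp add: power_mult_distrib fps_X_power_mult_nth del: power_bit_unfold)

lemma power_diag: "(A ^ N) $ N = 1"
  using A1 by (simp add: power_nth fps_power_zeroth F_nth)

lemma power_next: "(A ^ N) $ Suc N = of_nat N * A $ 2"
proof -
  have "(A ^ N) $ Suc N = (F ^ N) $ 1" by (simp add: power_nth)
  also have "\<dots> = of_nat N * F $ 1"
    by (rule fps_power_first_eq) (use A1 in \<open>simp add: F_nth\<close>)
  finally show ?thesis by (simp add: F_nth numeral_2_eq_2)
qed

lemma F0: "F $ 0 = 1"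
  using A1 by (simp add: F_nth)

text \<open>
  A factor \<open>(A ^ Suc k) $ (i + j - k)\<close> vanishes unless \<open>2 k < i + j\<close>, so for small \<open>j\<close> only a few
  terms of an Adem relation survive; \<open>S\<close> is a set that contains them.
\<close>

lemma relation:
  assumes "i > 2 * j" and S: "finite S"
    "\<And>k. k \<in> S \<Longrightarrow> i \<le> 2 * k \<and> k \<le> i + j"
    "\<And>k. i \<le> 2 * k \<Longrightarrow> 2 * k < i + j \<Longrightarrow> k \<notin> S \<Longrightarrow> A $ k * (A ^ Suc k) $ (i + j - k) = 0"
  shows "A $ j * (A ^ Suc j) $ i =
     (\<Sum>k\<in>S. of_nat ((k - j - 1) choose (2 * k - i)) * (A $ k * (A ^ Suc k) $ (i + j - k)))"
proof -
  have "A $ j * (A ^ Suc j) $ i = (\<Sum>k | i \<le> 2 * k \<and> k \<le> i + j.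
        of_nat ((k - j - 1) choose (2 * k - i)) * (A $ k * (A ^ Suc k) $ (i + j - k)))"
    using adem_relationsD[OF adem assms(1)] by simp
  also have "\<dots> = (\<Sum>k\<in>S. of_nat ((k - j - 1) choose (2 * k - i)) * (A $ k * (A ^ Suc k) $ (i + j - k)))"
  proof (rule sum.mono_neutral_right)
    show "finite {k. i \<le> 2 * k \<and> k \<le> i + j}" by (rule finite_subset[of _ "{..i + j}"]) auto
    show "S \<subseteq> {k. i \<le> 2 * k \<and> k \<le> i + j}" using S(2) by blast
    show "\<forall>k\<in>{k. i \<le> 2 * k \<and> k \<le> i + j} - S.
       of_nat ((k - j - 1) choose (2 * k - i)) * (A $ k * (A ^ Suc k) $ (i + j - k)) = 0"
    proof
      fix k assume k: "k \<in> {k. i \<le> 2 * k \<and> k \<le> i + j} - S"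
      show "of_nat ((k - j - 1) choose (2 * k - i)) * (A $ k * (A ^ Suc k) $ (i + j - k)) = 0"
      proof (cases "2 * k < i + j")
        case True
        then show ?thesis using S(3)[of k] k by (metis DiffD1 DiffD2 mem_Collect_eq mult_zero_right)
      next
        case False
        then have "(A ^ Suc k) $ (i + j - k) = 0" by (intro power_eq_0) auto
        then show ?thesis by (metis mult_zero_right)
      qed
    qed
  qed
  finally show ?thesis .
qed

lemma relation_2_even:
  assumes "k \<ge> 3"
  shows "A $ 2 * (A ^ 3) $ (2 * k) = of_nat (k + 1) * (A $ k * A $ 2)"
proof -
  have "A $ 2 * (A ^ Suc 2) $ (2 * k) =
     (\<Sum>k'\<in>{k}. of_nat ((k' - 2 - 1) choose (2 * k' - 2 * k)) * (A $ k' * (A ^ Suc k') $ (2 * k + 2 - k')))"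
    by (rule relation) (use assms in auto)
  moreover have "2 * k + 2 - k = Suc (Suc k)" by simp
  ultimately show ?thesis using power_next[of "Suc k"]
    by (simp add: eval_nat_numeral mult.commute mult.left_commute del: power_Suc power_bit_unfold)
qed

lemma relation_2_odd:
  assumes "k \<ge> 3"
  shows "A $ 2 * (A ^ 3) $ (2 * k - 1) = of_nat (k + 1) * A $ k"
proof -
  have "A $ 2 * (A ^ Suc 2) $ (2 * k - 1) =
     (\<Sum>k'\<in>{k}. of_nat ((k' - 2 - 1) choose (2 * k' - (2 * k - 1))) * (A $ k' * (A ^ Suc k') $ (2 * k - 1 + 2 - k')))"
    by (rule relation) (use assms in auto)
  moreover have "2 * k - 1 + 2 - k = Suc k" "2 * k - (2 * k - 1) = 1" using assms by simp_all
  moreover have "(of_nat (k - 3) :: bit) = of_nat (k + 1)"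
  proof -
    have "k + 1 = (k - 3) + 4" using assms by simp
    then show ?thesis by (simp only: of_nat_add) simp
  qed
  ultimately show ?thesis using power_diag[of "Suc k"]
    by (simp add: eval_nat_numeral mult.commute mult.left_commute del: power_Suc power_bit_unfold)
qed

text \<open>
  If \<open>a\<^sub>2 = 0\<close>, the relations for \<open>Q\<^sup>2\<^sup>i Q\<^sup>4 u\<close> say that \<open>(k + 1) a\<^sub>k = 0\<close>. So \<open>A / z\<close> is a square, which
  makes many coefficients of powers of \<open>A\<close> vanish in the relations below.
\<close>

lemma even_eq_0:
  assumes "A $ 2 = 0" "even k"
  shows "A $ k = 0"
proof -
  consider "k = 0" | "k = 2" | "k \<ge> 3" using assms(2) by (metis dvd_0_right le_less_linear less_Suc_eq less_one numeral_2_eq_2 numeral_3_eq_3 odd_one One_nat_def)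
  then show ?thesis
  proof cases
    case 3
    then show ?thesis using relation_2_odd[of k] assms by (cases "A $ k") auto
  qed (use A0 assms in auto)
qed

text \<open>
  For odd \<open>l\<close> and \<open>i = 4 l\<close> the only index left in the relation for \<open>Q\<^sup>2\<^sup>i Q\<^sup>6 u\<close> is \<open>k = 2 l + 1\<close>.
\<close>

lemma relation_3:
  assumes "A $ 2 = 0" "odd l"
  shows "A $ (2 * l + 1) = A $ 3 * A $ l"
proof (cases "l = 1")
  case True
  then show ?thesis using A1 by simp
next
  case False
  with assms(2) have l: "l \<ge> 3" by (cases l rule: nat.exhaust) (auto elim!: oddE)
  have "A $ 3 * (A ^ Suc 3) $ (4 * l) =
     (\<Sum>k\<in>{2 * l + 1}. of_nat ((k - 3 - 1) choose (2 * k - 4 * l)) * (A $ k * (A ^ Suc k) $ (4 * l + 3 - k)))"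
  proof (rule relation)
    fix k assume "4 * l \<le> 2 * k" "2 * k < 4 * l + 3" "k \<notin> {2 * l + 1}"
    then have "k = 2 * l" by auto
    then have "A $ k = 0" using even_eq_0[OF assms(1)] by simp
    then show "A $ k * (A ^ Suc k) $ (4 * l + 3 - k) = 0" by (metis mult_zero_left)
  qed (use l in auto)
  also have "\<dots> = of_nat ((2 * (l - 2) + 1) choose (2 * 1)) * (A $ (2 * l + 1) * (A ^ (2 * l + 2)) $ (2 * l + 2))"
  proof -
    have "2 * l + 1 - 3 - 1 = 2 * (l - 2) + 1" "2 * (2 * l + 1) - 4 * l = 2 * 1" "4 * l + 3 - (2 * l + 1) = 2 * l + 2"
      "Suc (2 * l + 1) = 2 * l + 2" using l by auto
    then show ?thesis by (simp only: sum.insert sum.empty finite.emptyI empty_iff not_False_eq_True add_0_right)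
  qed
  also have "\<dots> = of_nat (l - 2) * A $ (2 * l + 1)"
    unfolding choose_odd_even_bit power_diag by simp
  also have "of_nat (l - 2) = (1 :: bit)"
    using assms(2) l by (auto elim!: oddE)
  also have "(A ^ Suc 3) $ (4 * l) = A $ l"
  proof -
    have "Suc 3 = 2 * 2" by simp
    then have "(A ^ Suc 3) $ (4 * l) = (A ^ 2) $ (4 * l div 2)"
      by (simp only: bit_fps_even_power_nth) simp
    also have "\<dots> = A $ l" by (simp only: bit_fps_square_nth) simp
    finally show ?thesis .
  qed
  finally show ?thesis by simp
qed

text \<open>
  The relation for \<open>Q\<^sup>2\<^sup>i Q\<^sup>1\<^sup>0 u\<close> with \<open>i = 2 k\<close>: the indices \<open>k\<close> and \<open>k + 2\<close> are left. What matters is that all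
  other coefficients can be rewritten with smaller indices, so the binomial coefficient is not evaluated.
\<close>

lemma relation_5:
  assumes "A $ 2 = 0" "k = 4 * p + 1" "p \<ge> 2"
  shows "A $ 5 * (A ^ 3) $ k = A $ 3 * A $ k + of_nat ((k - 4) choose 4) * A $ (k + 2)"
proof -
  have "A $ 5 * (A ^ Suc 5) $ (2 * k) =
     (\<Sum>k'\<in>{k, k + 2}. of_nat ((k' - 5 - 1) choose (2 * k' - 2 * k)) * (A $ k' * (A ^ Suc k') $ (2 * k + 5 - k')))"
  proof (rule relation)
    fix k' assume "2 * k \<le> 2 * k'" "2 * k' < 2 * k + 5" "k' \<notin> {k, k + 2}"
    then have "k' = k + 1" by auto
    then have "A $ k' = 0" using even_eq_0[OF assms(1)] assms(2) by simp
    then show "A $ k' * (A ^ Suc k') $ (2 * k + 5 - k') = 0" by (metis mult_zero_left)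
  qed (use assms in auto)
  also have "\<dots> = A $ k * (A ^ Suc k) $ (k + 5) + of_nat ((k - 4) choose 4) * (A $ (k + 2) * (A ^ Suc (k + 2)) $ Suc (k + 2))"
  proof -
    have "k \<noteq> k + 2" by simp
    moreover have "2 * k - 2 * k = 0" "2 * k + 5 - k = k + 5" "k + 2 - 5 - 1 = k - 4" "2 * (k + 2) - 2 * k = 4"
      "2 * k + 5 - (k + 2) = Suc (k + 2)" by simp_all
    ultimately show ?thesis
      by (simp only: sum.insert sum.empty finite.emptyI finite.insertI singleton_iff empty_iff not_False_eq_True
          add_0_right binomial_n_0 of_nat_1 mult_1_left)
  qed
  also have "(A ^ Suc k) $ (k + 5) = A $ 3"
  proof -
    have "Suc k = 2 * (2 * p + 1)" using assms by simp
    then have "(A ^ Suc k) $ (k + 5) = (F ^ (2 * (2 * p + 1))) $ 4"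
      using power_nth[of "Suc k" "k + 5"] by simp
    also have "\<dots> = (F ^ (2 * p) * F) $ 2"
      by (simp only: bit_fps_even_power_nth power_add power_one_right) simp
    also have "\<dots> = (F ^ (2 * p)) $ 0 * F $ 2 + (F ^ (2 * p)) $ 1 * F $ 1 + (F ^ (2 * p)) $ 2 * F $ 0"
      by (rule fps_mult_nth_2)
    also have "(F ^ (2 * p)) $ 0 = 1" by (rule fps_power_zeroth_eq_one[OF F0])
    also have "F $ 1 = 0" using assms(1) by (simp add: F_nth numeral_2_eq_2)
    also have "(F ^ (2 * p)) $ 2 = 0"
      using fps_power_first_eq[OF F0, of p] \<open>F $ 1 = 0\<close>
      by (simp only: bit_fps_even_power_nth) simp
    finally show ?thesis by (simp add: F_nth eval_nat_numeral)
  qed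
  also have "(A ^ Suc (k + 2)) $ Suc (k + 2) = 1" by (rule power_diag)
  also have "(A ^ Suc 5) $ (2 * k) = (A ^ 3) $ k"
  proof -
    have "Suc 5 = 2 * 3" by simp
    then show ?thesis by (simp only: bit_fps_even_power_nth) simp
  qed
  finally show ?thesis by (simp only: mult_1_right mult.commute[of "A $ k" "A $ 3"])
qed

end

text \<open>
  If the first coefficient after the constant term 1 is in position at least \<open>r\<close>, then powers are
  linear up to that position.
\<close>

lemma power_nth_first:
  fixes F :: "bit fps"
  assumes "F $ 0 = 1" "\<And>m. 0 < m \<Longrightarrow> m < r \<Longrightarrow> F $ m = 0" "0 < m" "m \<le> r"
  shows "(F ^ n) $ m = of_nat n * F $ m"
  using assms(3,4)
proof (induction n)
  case 0
  then show ?case by simp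
next
  case (Suc n)
  have "(F ^ Suc n) $ m = (\<Sum>i=0..m. F $ i * (F ^ n) $ (m - i))"
    by (simp only: power_Suc fps_mult_nth)
  also have "\<dots> = (\<Sum>i\<in>{0, m}. F $ i * (F ^ n) $ (m - i))"
    by (rule sum.mono_neutral_right) (use assms(2)[of _] Suc.prems in auto)
  also have "\<dots> = (F ^ n) $ m + F $ m"
  proof -
    have "0 \<noteq> m" using Suc.prems by simp
    then have "(\<Sum>i\<in>{0, m}. F $ i * (F ^ n) $ (m - i)) = F $ 0 * (F ^ n) $ (m - 0) + F $ m * (F ^ n) $ (m - m)"
      by (simp only: sum.insert sum.empty finite.emptyI finite.insertI singleton_iff empty_iff not_False_eq_True add_0_right)
    then show ?thesis
      using assms(1) fps_power_zeroth_eq_one[of F n] by (simp only: diff_self_eq_0 diff_zero mult_1_left mult_1_right)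
  qed
  also have "\<dots> = of_nat (Suc n) * F $ m"
    using Suc by (simp only: of_nat_Suc distrib_right mult_1_left add.commute)
  finally show ?case .
qed

text \<open>
  Suppose \<open>j \<ge> 2\<close> were the first index with \<open>a\<^sub>j = 1\<close>. By the previous relations all indices with
  nonzero coefficient are 1 modulo 4. In the relation for \<open>Q\<^sup>2\<^sup>i Q\<^sup>2\<^sup>j u\<close> with \<open>i = 3 j - 1\<close> the left side is then 1.
  On the right the minimality of \<open>j\<close> leaves only \<open>k = 2 j - 1\<close>, whose binomial coefficient
  \<open>j - 2 choose j - 1\<close> is 0.
\<close>

lemma (in adem_series) eq_X:
  assumes "A $ 2 = 0" "A $ 3 = 0"
  shows "A = fps_X"
proof (rule ccontr)
  assume "A \<noteq> fps_X"
  then obtain n where n: "A $ n \<noteq> fps_X $ n" by (auto simp: fps_eq_iff)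
  have "n \<noteq> 0" by (rule notI) (use n A0 in simp)
  moreover have "n \<noteq> 1" by (rule notI) (use n A1 in simp)
  ultimately have ex: "n \<ge> 2 \<and> A $ n \<noteq> 0" using n by auto
  define j where "j = (LEAST j. j \<ge> 2 \<and> A $ j \<noteq> 0)"
  have j: "j \<ge> 2 \<and> A $ j \<noteq> 0" unfolding j_def by (rule LeastI[of "\<lambda>j. j \<ge> 2 \<and> A $ j \<noteq> 0", OF ex])
  have below: "A $ m = 0" if "2 \<le> m" "m < j" for m
    using not_less_Least[of m "\<lambda>j. j \<ge> 2 \<and> A $ j \<noteq> 0"] that by (auto simp: j_def)
  have mod4: "\<exists>q. k = 4 * q + 1" if "A $ k \<noteq> 0" for k
  proof -
    have "odd k" using that even_eq_0[OF assms(1)] by blast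
    then obtain l where l: "k = 2 * l + 1" by (elim oddE)
    have "even l"
    proof (rule ccontr)
      assume "odd l"
      then have "A $ k = 0" using relation_3[OF assms(1), of l] assms(2) l by simp
      then show False using that by simp
    qed
    then obtain q where "l = 2 * q" by (elim evenE)
    then have "k = 4 * q + 1" using l by simp
    then show ?thesis by blast
  qed
  obtain p where p: "j = 4 * p + 1" using mod4 j by blast
  have F_below: "F $ m = 0" if "0 < m" "m < j - 1" for m
    using below[of "Suc m"] that by (simp add: F_nth)
  have A_F: "(A ^ Suc k) $ (2 * m + Suc k) = (F ^ (2 * q + 1)) $ m" if "k = 4 * q + 1" for k m q
  proof -
    have "Suc k = 2 * (2 * q + 1)" using that by simp
    then have "(A ^ Suc k) $ (2 * m + Suc k) = (F ^ (2 * (2 * q + 1))) $ (2 * m)"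
      using power_nth[of "Suc k" "2 * m + Suc k"] by simp
    also have "\<dots> = (F ^ (2 * q + 1)) $ m" by (simp only: bit_fps_even_power_nth) simp
    finally show ?thesis .
  qed
  have "A $ j * (A ^ Suc j) $ (3 * j - 1) =
     (\<Sum>k\<in>{2 * j - 1}. of_nat ((k - j - 1) choose (2 * k - (3 * j - 1))) * (A $ k * (A ^ Suc k) $ (3 * j - 1 + j - k)))"
  proof (rule relation)
    fix k assume k: "3 * j - 1 \<le> 2 * k" "2 * k < 3 * j - 1 + j" "k \<notin> {2 * j - 1}"
    show "A $ k * (A ^ Suc k) $ (3 * j - 1 + j - k) = 0"
    proof (cases "A $ k = 0")
      case False
      then obtain q where q: "k = 4 * q + 1" using mod4 by blast
      define m where "m = 2 * j - 1 - k"
      have m: "0 < m" "m < j - 1" "3 * j - 1 + j - k = 2 * m + Suc k" using k j by (auto simp: m_def)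
      have "(A ^ Suc k) $ (3 * j - 1 + j - k) = of_nat (2 * q + 1) * F $ m"
        unfolding m(3) A_F[OF q] by (rule power_nth_first[where r = "j - 1"]) (use F0 F_below m in auto)
      also have "\<dots> = 0" using F_below m by simp
      finally show ?thesis by (simp only: mult_zero_right)
    qed (simp only: mult_zero_left)
  qed (use j in linarith | simp)+
  also have "\<dots> = 0"
  proof -
    have "2 * j - 1 - j - 1 < 2 * (2 * j - 1) - (3 * j - 1)" using j by auto
    then have "(2 * j - 1 - j - 1) choose (2 * (2 * j - 1) - (3 * j - 1)) = 0" by (rule binomial_eq_0)
    then show ?thesis by (simp only: sum.insert sum.empty finite.emptyI empty_iff not_False_eq_True add_0_right
       of_nat_0 mult_zero_left)
  qed
  also have "(A ^ Suc j) $ (3 * j - 1) = 1"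
  proof -
    have e: "3 * j - 1 = 2 * (j - 1) + Suc j" using j by auto
    have "(A ^ Suc j) $ (3 * j - 1) = of_nat (2 * p + 1) * F $ (j - 1)"
      unfolding e A_F[OF p] by (rule power_nth_first[where r = "j - 1"]) (use F0 F_below j in auto)
    also have "F $ (j - 1) = 1" using j by (simp add: F_nth)
    finally show ?thesis by simp
  qed
  finally show False using j by simp
qed

lemma power_nth_cong:
  fixes F G :: "bit fps"
  assumes "\<And>m. m \<le> r \<Longrightarrow> F $ m = G $ m"
  shows "m \<le> r \<Longrightarrow> (F ^ n) $ m = (G ^ n) $ m"
proof (induction n arbitrary: m)
  case (Suc n)
  have "(F ^ Suc n) $ m = (\<Sum>i=0..m. F $ i * (F ^ n) $ (m - i))" by (simp only: power_Suc fps_mult_nth)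
  also have "\<dots> = (\<Sum>i=0..m. G $ i * (G ^ n) $ (m - i))"
    by (rule sum.cong) (use Suc assms in auto)
  also have "\<dots> = (G ^ Suc n) $ m" by (simp only: power_Suc fps_mult_nth)
  finally show ?case .
qed simp

text \<open>
  In \<open>F\<^sup>3 = F\<^sup>2 F\<close> the top coefficient of \<open>F\<close> enters linearly, because the coefficients of \<open>F\<^sup>2\<close> are those of \<open>F\<close>
  at half the index. The relations below determine coefficients of \<open>A\<^sup>3\<close>, and this lemma recovers \<open>A\<close> from them.
\<close>

lemma cube_nth_top:
  fixes F G :: "bit fps"
  assumes "\<And>m. m < r \<Longrightarrow> F $ m = G $ m" "F $ 0 = 1" "G $ 0 = 1" "r > 0" "(F ^ 3) $ r = (G ^ 3) $ r"
  shows "F $ r = G $ r"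
proof -
  have split: "(H ^ 3) $ r = H $ r + (\<Sum>i=Suc 0..r. (H ^ 2) $ i * H $ (r - i))" if "H $ 0 = 1" for H :: "bit fps"
  proof -
    have "(H ^ 3) $ r = (\<Sum>i=0..r. (H ^ 2) $ i * H $ (r - i))"
      by (simp only: power3_eq_cube power2_eq_square fps_mult_nth)
    also have "\<dots> = (H ^ 2) $ 0 * H $ (r - 0) + (\<Sum>i=Suc 0..r. (H ^ 2) $ i * H $ (r - i))"
      by (rule sum.atLeast_Suc_atMost) simp
    also have "(H ^ 2) $ 0 = 1" using that by (rule fps_power_zeroth_eq_one)
    finally show ?thesis by simp
  qed
  have "(\<Sum>i=Suc 0..r. (F ^ 2) $ i * F $ (r - i)) = (\<Sum>i=Suc 0..r. (G ^ 2) $ i * G $ (r - i))"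
    by (rule sum.cong) (use assms(1) in \<open>auto simp: bit_fps_square_nth\<close>)
  then show ?thesis using assms(5) unfolding split[OF assms(2)] split[OF assms(3)] by (simp only: add_right_cancel)
qed

text \<open>
  When \<open>a\<^sub>2 = 1\<close> the relations for \<open>Q\<^sup>2\<^sup>i Q\<^sup>4 u\<close> express the coefficient of \<open>z\<^sup>n\<^sup>+\<^sup>2\<close> in \<open>A\<^sup>3\<close> through some
  \<open>a\<^sub>k\<close> with \<open>k < n\<close>, so the series can be computed one coefficient at a time.
\<close>

lemma adem_series_eq_if_second_coeff:
  assumes "adem_series A" "adem_series A'" "A $ 2 = 1" "A' $ 2 = 1"
  shows "A = A'"
proof (rule fps_ext)
  interpret A: adem_series A by fact
  interpret A': adem_series A' by fact
  fix n show "A $ n = A' $ n"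
  proof (induction n rule: less_induct)
    case (less n)
    show ?case
    proof (cases "n \<le> 2")
      case True
      then consider "n = 0" | "n = 1" | "n = 2" by linarith
      then show ?thesis using A.A0 A.A1 A'.A0 A'.A1 assms by cases simp_all
    next
      case False
      have cube: "(A ^ 3) $ (n + 2) = (A' ^ 3) $ (n + 2)"
      proof (cases "even n")
        case True
        then obtain m where m: "n = 2 * m" by blast
        then have "n + 2 = 2 * (m + 1)" "m + 1 \<ge> 3" "A $ (m + 1) = A' $ (m + 1)" using False less by auto
        moreover have "(A ^ 3) $ (2 * (m + 1)) = of_nat (m + 1 + 1) * A $ (m + 1)"
          using A.relation_2_even[of "m + 1"] calculation(2) by (simp only: assms mult_1_left mult_1_right)
        moreover have "(A' ^ 3) $ (2 * (m + 1)) = of_nat (m + 1 + 1) * A' $ (m + 1)"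
          using A'.relation_2_even[of "m + 1"] calculation(2) by (simp only: assms mult_1_left mult_1_right)
        ultimately show ?thesis by (simp only:)
      next
        case odd: False
        then obtain m where m: "n = 2 * m + 1" by (elim oddE)
        then have 1: "n + 2 = 2 * (m + 2) - 1" "m + 2 \<ge> 3" using False by auto
        have "of_nat (m + 2 + 1) * A $ (m + 2) = of_nat (m + 2 + 1) * A' $ (m + 2)"
          \<comment> \<open>For \<open>n = 3\<close> the index \<open>m + 2\<close> is not smaller than \<open>n\<close>, but the factor is 4.\<close>
        proof (cases "m = 1")
          case True
          then show ?thesis by simp
        next
          case False
          then show ?thesis using less[of "m + 2"] m \<open>\<not> n \<le> 2\<close> by simp
        qed
        then show ?thesis using A.relation_2_odd[OF 1(2)] A'.relation_2_odd[OF 1(2)]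
          by (simp only: 1(1) assms mult_1_left)
      qed
      have "A.F $ (n - 1) = A'.F $ (n - 1)"
      proof (rule cube_nth_top)
        show "A.F $ m = A'.F $ m" if "m < n - 1" for m
          using less[of "Suc m"] that by (simp add: A.F_nth A'.F_nth)
        show "(A.F ^ 3) $ (n - 1) = (A'.F ^ 3) $ (n - 1)"
          using cube A.power_nth[of 3 "n + 2"] A'.power_nth[of 3 "n + 2"] False by simp
      qed (use False A.F0 A'.F0 in auto)
      then show ?thesis using False by (simp add: A.F_nth A'.F_nth)
    qed
  qed
qed

text \<open>
  When \<open>a\<^sub>2 = 0\<close> and \<open>a\<^sub>3 = 1\<close>, the coefficients of even index vanish, \<open>a\<close> at \<open>2 l + 1\<close> is \<open>a\<^sub>l\<close> for odd \<open>l\<close>, and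
  \<open>relation_5\<close> reduces the indices 1 modulo 4 to smaller ones, starting with 9. The value \<open>a\<^sub>5\<close> is free.
\<close>

lemma adem_series_eq_if_fifth_coeff:
  assumes "adem_series A" "adem_series A'" "A $ 2 = 0" "A' $ 2 = 0" "A $ 3 = 1" "A' $ 3 = 1" "A $ 5 = A' $ 5"
  shows "A = A'"
proof (rule fps_ext)
  interpret A: adem_series A by fact
  interpret A': adem_series A' by fact
  fix n show "A $ n = A' $ n"
  proof (induction n rule: less_induct)
    case (less n)
    show ?case
    proof (cases "even n")
      case True
      then show ?thesis using A.even_eq_0 A'.even_eq_0 assms by simp
    next
      case False
      then obtain l where l: "n = 2 * l + 1" by (elim oddE)
      show ?thesis
      proof (cases "even l")
        case False
        then show ?thesis using A.relation_3 A'.relation_3 assms less[of l] l by simp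
      next
        case True
        then obtain p where p: "n = 4 * p + 1" using l by (auto elim!: evenE)
        consider "p = 0" | "p = 1" | "p \<ge> 2" by linarith
        then show ?thesis
        proof cases
          case 3
          have "A $ (n + 2) = A' $ (n + 2)"
            using A.relation_3[of "2 * p + 1"] A'.relation_3[of "2 * p + 1"] less[of "2 * p + 1"] assms p 3 by simp
          moreover have "(A ^ 3) $ n = (A' ^ 3) $ n"
          proof -
            have "(A.F ^ 3) $ (n - 3) = (A'.F ^ 3) $ (n - 3)"
              by (rule power_nth_cong[where r = "n - 3"]) (use less p 3 in \<open>auto simp: A.F_nth A'.F_nth\<close>)
            then show ?thesis using A.power_nth[of 3 n] A'.power_nth[of 3 n] p 3 by simp
          qed
          ultimately have "A $ 3 * A $ n = A' $ 3 * A' $ n"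
            using A.relation_5[OF _ p 3] A'.relation_5[OF _ p 3] assms by (metis add_right_cancel)
          then show ?thesis by (simp only: assms mult_1_left)
        qed (use A.A1 A'.A1 assms p in auto)
      qed
    qed
  qed
qed

lemma adem_seriesI:
  assumes "symmetric_series A" "A $ 0 = 0" "A $ 1 = 1"
  shows "adem_series A"
  using assms symmetric_series_imp_adem_relations by unfold_locales auto

lemma catalan_nth: "catalan_series $ n = of_bool (odd n \<and> (\<exists>k. (n + 1) div 2 = 2 ^ k))"
  by (simp add: catalan_series_def bit_fps_square_nth artin_schreier_series_def)

lemma catalan_nths: "catalan_series $ 1 = 1" "catalan_series $ 2 = 0" "catalan_series $ 3 = 1" "catalan_series $ 5 = 0"
proof -
  have "3 \<noteq> (2::nat) ^ k" for k by (cases k) (simp_all, presburger)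
  then show "catalan_series $ 5 = 0" by (simp add: catalan_nth)
  show "catalan_series $ 1 = 1" "catalan_series $ 2 = 0" "catalan_series $ 3 = 1"
    by (auto simp: catalan_nth intro: exI[of _ 0] exI[of _ 1])
qed

lemma adem_series_examples:
  "adem_series fps_X" "adem_series all_series" "adem_series odd_series" "adem_series catalan_series"
proof -
  have "all_series $ 1 = 1" "odd_series $ 1 = 1" by (simp_all add: all_series_def odd_series_def)
  then show "adem_series fps_X" "adem_series all_series" "adem_series odd_series" "adem_series catalan_series"
    using catalan_nths(1) symmetric_X symmetric_all_series symmetric_odd_series symmetric_catalan_series
    by (simp_all add: adem_seriesI)
qed

lemma adem_series_classification:
  "{A. adem_series A} = {fps_X, all_series, odd_series, catalan_series}"
proof (intro equalityI subsetI)
  fix A assume "A \<in> {A. adem_series A}"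
  then have A: "adem_series A" by simp
  consider "A $ 2 = 1" | "A $ 2 = 0" "A $ 3 = 0" | "A $ 2 = 0" "A $ 3 = 1" "A $ 5 = 1" | "A $ 2 = 0" "A $ 3 = 1" "A $ 5 = 0"
    by (metis bit_not_one_iff)
  then show "A \<in> {fps_X, all_series, odd_series, catalan_series}"
  proof cases
    case 1
    then have "A = all_series"
      by (intro adem_series_eq_if_second_coeff A adem_series_examples) (simp_all add: all_series_def)
    then show ?thesis by simp
  next
    case 2
    then show ?thesis using adem_series.eq_X[OF A] by simp
  next
    case 3
    then have "A = odd_series"
      by (intro adem_series_eq_if_fifth_coeff A adem_series_examples) (simp_all add: odd_series_def)
    then show ?thesis by simp
  next
    case 4
    then have "A = catalan_series"
      by (intro adem_series_eq_if_fifth_coeff A adem_series_examples) (simp_all add: catalan_nths)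
    then show ?thesis by simp
  qed
qed (use adem_series_examples in auto)

lemma card_series: "card {fps_X, all_series, odd_series, catalan_series} = 4"
proof -
  have "all_series $ 2 = 1" "odd_series $ 2 = 0" "odd_series $ 3 = 1" "odd_series $ 5 = 1" "fps_X $ 2 = (0::bit)" "fps_X $ 3 = (0::bit)"
    by (auto simp: all_series_def odd_series_def)
  then have "fps_X \<noteq> all_series" "fps_X \<noteq> odd_series" "fps_X \<noteq> catalan_series" "all_series \<noteq> odd_series"
    "all_series \<noteq> catalan_series" "odd_series \<noteq> catalan_series"
    using catalan_nths by (metis zero_neq_one)+
  then show ?thesis by simp
qed

section \<open>Structures from series\<close>

definition generator_series :: "bit fps \<Rightarrow> bit poly fps" where
  "generator_series A = Abs_fps (\<lambda>i. if even i then monom (A $ (i div 2)) (Suc (i div 2)) else 0)"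

text \<open>
  The sum \<open>\<Sum> Q\<^sup>i p z\<^sup>i\<close> for the structure with \<open>\<Sum> Q\<^sup>i u z\<^sup>i\<close> equal to the given series. As evaluation of a polynomial
  it is a ring homomorphism, and this is the Cartan formula.
\<close>

definition total_operation :: "bit fps \<Rightarrow> bit poly \<Rightarrow> bit poly fps" where
  "total_operation A p = poly (map_poly (\<lambda>c. fps_const [:c:]) p) (generator_series A)"

definition operation :: "bit fps \<Rightarrow> nat \<Rightarrow> bit poly \<Rightarrow> bit poly" where
  "operation A i p = total_operation A p $ i"

lemma total_operation_0 [simp]: "total_operation A 0 = 0"
  by (simp add: total_operation_def)

lemma total_operation_pCons:
  "total_operation A (pCons c p) = fps_const [:c:] + generator_series A * total_operation A p"
  by (simp add: total_operation_def map_poly_pCons)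

lemma total_operation_1 [simp]: "total_operation A 1 = 1"
  unfolding one_pCons by (subst total_operation_pCons) (simp flip: one_pCons)

lemma total_operation_add: "total_operation A (p + q) = total_operation A p + total_operation A q"
proof (induction p q rule: poly_induct2)
  case (pCons a p b q)
  have "fps_const [:a + b:] = fps_const [:a:] + fps_const [:b:]" by simp
  then show ?case unfolding add_pCons total_operation_pCons pCons by (simp add: algebra_simps)
qed simp

lemma total_operation_smult: "total_operation A (smult c p) = fps_const [:c:] * total_operation A p"
proof (induction p)
  case (pCons a p)
  have "fps_const [:c * a:] = fps_const [:c:] * fps_const [:a:]" by simp
  then show ?case unfolding smult_pCons total_operation_pCons pCons.IH by (simp add: algebra_simps)
qed simp

lemma total_operation_mult: "total_operation A (p * q) = total_operation A p * total_operation A q"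
proof (induction p)
  case (pCons a p)
  then show ?case
    by (simp add: mult_pCons_left total_operation_add total_operation_smult total_operation_pCons algebra_simps)
qed simp

lemma total_operation_monom: "total_operation A (monom c N) = fps_const [:c:] * generator_series A ^ N"
  by (induction N) (simp_all add: monom_0 monom_Suc total_operation_pCons algebra_simps)

lemma sum_even_indices:
  fixes h :: "nat \<Rightarrow> 'a::comm_monoid_add"
  assumes "\<And>i. odd i \<Longrightarrow> h i = 0"
  shows "sum h {0..2 * m} = (\<Sum>i=0..m. h (2 * i))"
  by (induction m) (simp_all add: assms)

lemma monom_sum_bit: "monom (sum f S) n = (\<Sum>x\<in>S. monom (f x) n)"
  by (induction S rule: infinite_finite_induct) (auto simp flip: add_monom)

lemma generator_series_power_nth:
  "(generator_series A ^ N) $ n = (if even n then monom ((A ^ N) $ (n div 2)) (N + n div 2) else 0)"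
proof (induction N arbitrary: n)
  case 0
  show ?case
  proof (cases "n = 0")
    case False
    then have "even n \<Longrightarrow> n div 2 \<noteq> 0" by (cases n) auto
    then show ?thesis using False by auto
  qed (simp add: monom_0)
next
  case (Suc N)
  let ?h = "\<lambda>i. generator_series A $ i * (generator_series A ^ N) $ (n - i)"
  have g: "generator_series A $ i = (if even i then monom (A $ (i div 2)) (Suc (i div 2)) else 0)" for i
    by (simp add: generator_series_def)
  have h: "?h i = (if even i \<and> even (n - i) then
      monom (A $ (i div 2) * (A ^ N) $ ((n - i) div 2)) (Suc (i div 2) + (N + (n - i) div 2)) else 0)" for i
    unfolding Suc.IH g
    by (cases "even i"; cases "even (n - i)")
       (simp_all only: if_True if_False mult_monom mult_zero_left mult_zero_right simp_thms)
  have sum: "(generator_series A ^ Suc N) $ n = sum ?h {0..n}"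
    by (simp only: power_Suc fps_mult_nth)
  show ?case
  proof (cases "even n")
    case True
    then obtain m where m: "n = 2 * m" by blast
    have "sum ?h {0..2 * m} = (\<Sum>i=0..m. ?h (2 * i))"
      by (rule sum_even_indices) (simp only: h, simp)
    also have "\<dots> = (\<Sum>i=0..m. monom (A $ i * (A ^ N) $ (m - i)) (Suc N + m))"
    proof (rule sum.cong)
      fix i assume "i \<in> {0..m}"
      then have "2 * i div 2 = i" "(n - 2 * i) div 2 = m - i" "even (n - 2 * i)" "even (2 * i)"
          "Suc i + (N + (m - i)) = Suc N + m" using m by auto
      then show "?h (2 * i) = monom (A $ i * (A ^ N) $ (m - i)) (Suc N + m)"
        by (simp only: h if_True simp_thms)
    qed simp
    also have "\<dots> = monom ((A ^ Suc N) $ m) (Suc N + m)"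
      by (simp only: monom_sum_bit[symmetric] power_Suc fps_mult_nth)
    finally show ?thesis using sum m by simp
  next
    case False
    have "sum ?h {0..n} = 0"
      by (rule sum.neutral) (use False in \<open>simp only: h, auto\<close>)
    then show ?thesis using sum False by simp
  qed
qed

lemma operation_monom_even: "operation A (2 * i) (monom c N) = monom (c * (A ^ N) $ i) (N + i)"
proof -
  have "even (2 * i)" "2 * i div 2 = i" by simp_all
  then show ?thesis
    by (simp only: operation_def total_operation_monom generator_series_power_nth if_True fps_mult_left_const_nth
        monom_0[symmetric] mult_monom add_0_left)
qed

lemma operation_monom_odd: "odd i \<Longrightarrow> operation A i (monom c N) = 0"
  by (simp add: operation_def total_operation_monom generator_series_power_nth)

lemma operation_0 [simp]: "operation A i 0 = 0"
  by (simp add: operation_def)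

lemma operation_add: "operation A i (p + q) = operation A i p + operation A i q"
  by (simp add: operation_def total_operation_add)

lemma bit_poly_additive_induct [case_names zero add monom]:
  fixes p :: "bit poly"
  assumes "P 0" "\<And>p q. P p \<Longrightarrow> P q \<Longrightarrow> P (p + q)" "\<And>N. P (monom 1 N)"
  shows "P p"
proof -
  have m: "P (monom c N)" for c N
    by (cases c) (use assms in auto)
  have "P (\<Sum>i\<in>S. monom (coeff p i) i)" if "finite S" for S
    using that by (induction S) (use assms(1,2) m in auto)
  then have "P (\<Sum>i\<le>degree p. monom (coeff p i) i)" by simp
  then show ?thesis by (simp only: poly_as_sum_of_monoms)
qed

lemma sum_antidiagonal: "(\<Sum>(i, j) | i + j = n. f i j) = (\<Sum>i=0..n. f i (n - i))" for n :: nat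
  by (rule sum.reindex_bij_witness[of _ "\<lambda>i. (i, n - i)" fst]) auto

lemma grading_iff: "x \<in> F2u_grading d \<longleftrightarrow> x = 0 \<or> (\<exists>N. d = 2 * N \<and> x = monom 1 N)"
proof
  assume x: "x \<in> F2u_grading d"
  show "x = 0 \<or> (\<exists>N. d = 2 * N \<and> x = monom 1 N)"
  proof (cases "x = 0")
    case False
    then obtain N where N: "coeff x N \<noteq> 0" by (metis leading_coeff_0_iff)
    then have d: "d = 2 * N" using x by (auto simp: F2u_grading_def)
    have "x = monom 1 N"
    proof (rule poly_eqI)
      fix n
      have "coeff x n = 0 \<or> n = N" using x d by (simp only: F2u_grading_def mem_Collect_eq) fastforce
      then show "coeff x n = coeff (monom 1 N) n" using N by (cases "n = N") auto
    qed
    then show ?thesis using d by blast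
  qed simp
next
  show "x \<in> F2u_grading d" if "x = 0 \<or> (\<exists>N. d = 2 * N \<and> x = monom 1 N)"
    using that by (elim disjE exE conjE) (simp_all add: F2u_grading_def)
qed

text \<open>
  Halving the indices: terms with odd \<open>k\<close> vanish, and for \<open>k = 2 k'\<close> the binomial coefficient has odd
  upper and even lower entry, so that it may be halved modulo 2.
\<close>

lemma adem_sum_even:
  assumes "i > 2 * j"
  shows "(\<Sum>k | 2 * i \<le> 2 * k \<and> k \<le> 2 * i + 2 * j.
      of_nat ((k - 2 * j - 1) choose (2 * k - 2 * i)) *
        operation A (2 * i + 2 * j - k) (operation A k (monom 1 N))) =
    monom (\<Sum>k | i \<le> 2 * k \<and> k \<le> i + j.
      of_nat ((k - j - 1) choose (2 * k - i)) * ((A ^ N) $ k * (A ^ (N + k)) $ (i + j - k))) (N + j + i)"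
    (is "sum ?g ?S = monom (sum ?f ?R) _")
proof -
  have "sum ?g ?S = sum ?g ((\<lambda>k. 2 * k) ` ?R)"
  proof (rule sum.mono_neutral_right)
    show "finite ?S" by (rule finite_subset[of _ "{..2 * i + 2 * j}"]) auto
    show "\<forall>k \<in> ?S - (\<lambda>k. 2 * k) ` ?R. ?g k = 0"
    proof
      fix k assume k: "k \<in> ?S - (\<lambda>k. 2 * k) ` ?R"
      have "odd k"
      proof
        assume "even k"
        then obtain k' where "k = 2 * k'" by blast
        then show False using k by auto
      qed
      then show "?g k = 0" by (simp add: operation_monom_odd)
    qed
  qed auto
  also have "\<dots> = (\<Sum>k\<in>?R. ?g (2 * k))"
    by (subst sum.reindex) (auto simp: inj_on_def)
  also have "\<dots> = (\<Sum>k\<in>?R. monom (?f k) (N + j + i))"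
  proof (rule sum.cong)
    fix k assume k: "k \<in> ?R"
    then have e: "2 * k - 2 * j - 1 = 2 * (k - j - 1) + 1" "2 * (2 * k) - 2 * i = 2 * (2 * k - i)"
      "2 * i + 2 * j - 2 * k = 2 * (i + j - k)" "N + k + (i + j - k) = N + j + i"
      using assms by auto
    have "?g (2 * k) = of_nat ((2 * (k - j - 1) + 1) choose (2 * (2 * k - i))) *
        monom (1 * (A ^ N) $ k * (A ^ (N + k)) $ (i + j - k)) (N + j + i)"
      unfolding e(1-3) operation_monom_even e(4) ..
    also have "\<dots> = monom (?f k) (N + j + i)"
      unfolding of_nat_poly choose_odd_even_bit mult_1_left by (simp add: smult_monom)
    finally show "?g (2 * k) = monom (?f k) (N + j + i)" .
  qed simp
  finally show ?thesis by (simp only: monom_sum_bit)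
qed

text \<open>
  If \<open>i\<close> or \<open>j\<close> is odd, the left side is zero. On the right the operations are zero when \<open>i + j\<close> is odd;
  when both are odd and \<open>k\<close> is even, the binomial coefficient is, having even upper and odd lower entry.
\<close>

lemma operation_adem_monom:
  assumes "adem_relations A N" "i > 2 * j"
  shows "operation A i (operation A j (monom 1 N)) =
        (\<Sum>k | i \<le> 2 * k \<and> k \<le> i + j.
           of_nat ((k - j - 1) choose (2 * k - i)) * operation A (i + j - k) (operation A k (monom 1 N)))"
    (is "?l = sum ?g ?S")
proof (cases "even i \<and> even j")
  case True
  then obtain i' j' where ij: "i = 2 * i'" "j = 2 * j'" by blast
  with assms have less: "i' > 2 * j'" by simp
  show ?thesis
    unfolding ij adem_sum_even[OF less] operation_monom_even adem_relationsD[OF assms(1) less, symmetric] by simp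
next
  case False
  have l: "?l = 0"
  proof (cases "even j")
    case True
    then obtain j' where "j = 2 * j'" by blast
    then show ?thesis using False by (simp only: operation_monom_even) (simp add: operation_monom_odd)
  qed (simp add: operation_monom_odd)
  have g: "?g k = 0" if "k \<in> ?S" for k
  proof (cases "even k")
    case True
    then obtain k' where k': "k = 2 * k'" by blast
    show ?thesis
    proof (cases "even (i + j)")
      case True
      with False have odd: "odd i" "odd j" by auto
      then obtain i' j' where ij: "i = 2 * i' + 1" "j = 2 * j' + 1" by (elim oddE)
      then have "k - j - 1 = 2 * (k' - j' - 1)" "2 * k - i = 2 * (k - i' - 1) + 1"
        using k' that assms by auto
      then have "(of_nat ((k - j - 1) choose (2 * k - i)) :: bit poly) = 0"
        by (simp only: of_nat_poly choose_even_odd_bit) simp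
      then show ?thesis by (simp only: mult_zero_left)
    next
      case False
      then have "odd (i + j - k)" using k' that by auto
      then show ?thesis by (simp only: k' operation_monom_even) (simp add: operation_monom_odd)
    qed
  qed (simp add: operation_monom_odd)
  have "sum ?g ?S = 0" by (rule sum.neutral) (use g in blast)
  then show ?thesis by (simp only: l)
qed

lemma dyer_lashof_algebra_operation:
  assumes A: "adem_series A"
  shows "dyer_lashof_algebra F2u_grading (operation A)"
proof
  interpret adem_series A by fact
  \<comment> \<open>The symmetry of \<open>A\<close>, known from the classification, gives the relations on all powers of \<open>u\<close>.\<close>
  have half: "adem_relations A N" for N
  proof -
    have "symmetric_series A"
    proof -
      have "A \<in> {fps_X, all_series, odd_series, catalan_series}"
        using A adem_series_classification by blast
      then show ?thesis
        using symmetric_X symmetric_all_series symmetric_odd_series symmetric_catalan_series by auto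
    qed
    then show ?thesis using A0 by (rule symmetric_series_imp_adem_relations)
  qed
  show "operation A i (x + y) = operation A i x + operation A i y" for i x y
    by (rule operation_add)
  show "operation A i x \<in> F2u_grading (d + i)" if x: "x \<in> F2u_grading d" for i d x
  proof -
    consider "x = 0" | N where "d = 2 * N" "x = monom 1 N" using x by (auto simp: grading_iff)
    then show ?thesis
    proof cases
      case 2
      show ?thesis
      proof (cases "even i")
        case True
        then obtain m where "i = 2 * m" by blast
        then show ?thesis using 2 by (auto simp: operation_monom_even F2u_grading_def coeff_monom)
      qed (use 2 in \<open>simp add: operation_monom_odd F2u_grading_def\<close>)
    qed (simp add: F2u_grading_def)
  qed
  show "operation A i (operation A j x) =
        (\<Sum>k | i \<le> 2 * k \<and> k \<le> i + j.
           of_nat ((k - j - 1) choose (2 * k - i)) * operation A (i + j - k) (operation A k x))"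
    if "i > 2 * j" for i j x
  proof (induction x rule: bit_poly_additive_induct)
    case (add p q)
    then show ?case by (simp only: operation_add sum.distrib distrib_left)
  next
    case (monom N)
    show ?case using half that by (rule operation_adem_monom)
  qed simp
  show "operation A n (x * y) = (\<Sum>(i, j) | i + j = n. operation A i x * operation A j y)" for n x y
    by (simp add: sum_antidiagonal operation_def total_operation_mult fps_mult_nth)
  show "operation A i 1 = 0" if "i \<noteq> 0" for i
    using that by (simp add: operation_def)
  show "operation A 0 1 = 1"
    by (simp add: operation_def)
  show "operation A i x = 0" if x: "x \<in> F2u_grading d" and less: "i < d" for i d x
  proof -
    consider "x = 0" | N where "d = 2 * N" "x = monom 1 N" using x by (auto simp: grading_iff)
    then show ?thesis
    proof cases
      case 2
      show ?thesis
      proof (cases "even i")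
        case True
        then obtain m where m: "i = 2 * m" by blast
        then have "(A ^ N) $ m = 0" using 2 less by (intro power_eq_0) simp
        then show ?thesis unfolding 2 m operation_monom_even by simp
      qed (use 2 in \<open>simp add: operation_monom_odd\<close>)
    qed simp
  qed
  show "operation A d x = x ^ 2" if x: "x \<in> F2u_grading d" for d x
  proof -
    consider "x = 0" | N where "d = 2 * N" "x = monom 1 N" using x by (auto simp: grading_iff)
    then show ?thesis
    proof cases
      case 2
      then show ?thesis using power_diag[of N]
        by (simp only: 2 operation_monom_even power2_eq_square mult_monom mult_1_left)
    qed simp
  qed
qed

definition coefficient_series :: "(nat \<Rightarrow> bit poly \<Rightarrow> bit poly) \<Rightarrow> bit fps" where
  "coefficient_series Q = Abs_fps (\<lambda>m. coeff (Q (2 * m) (monom 1 1)) (Suc m))"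

lemma coefficient_series_operation: "coefficient_series (operation A) = A"
  by (rule fps_ext) (simp add: coefficient_series_def operation_monom_even coeff_monom del: One_nat_def)

text \<open>
  The grading forces \<open>Q\<^sup>i u\<close> to be a multiple of the one monomial in degree \<open>2 + i\<close>, and the Cartan formula makes
  \<open>p \<mapsto> \<Sum> Q\<^sup>i p z\<^sup>i\<close> a ring homomorphism, which is determined by its value at \<open>u\<close>.
\<close>

lemma dyer_lashof_algebra_eq_operation:
  assumes "dyer_lashof_algebra F2u_grading Q"
  shows "Q = operation (coefficient_series Q)"
proof -
  interpret dyer_lashof_algebra F2u_grading Q by fact
  define A where "A = coefficient_series Q"
  define TQ where "TQ = (\<lambda>p. Abs_fps (\<lambda>i. Q i p))"
  have u: "monom 1 1 \<in> F2u_grading 2" by (auto simp: F2u_grading_def coeff_monom split: if_splits)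
  have gen: "TQ (monom 1 1) = generator_series A"
  proof (rule fps_ext)
    fix i
    have deg: "Q i (monom 1 1) \<in> F2u_grading (2 + i)" using u by (rule degree)
    show "TQ (monom 1 1) $ i = generator_series A $ i"
    proof (cases "even i")
      case True
      then obtain m where m: "i = 2 * m" by blast
      then have "N = Suc m" if "2 + i = 2 * N" for N using that by simp
      then consider "Q i (monom 1 1) = 0" | "Q i (monom 1 1) = monom 1 (Suc m)"
        using deg unfolding grading_iff by metis
      then show ?thesis
        using m by cases (simp_all add: TQ_def generator_series_def A_def coefficient_series_def coeff_monom del: One_nat_def)
    next
      case False
      then have "Q i (monom 1 1) = 0" using deg by (auto simp: grading_iff) presburger
      then show ?thesis using False by (simp add: TQ_def generator_series_def)
    qed
  qed
  have TQ_add: "TQ (p + q) = TQ p + TQ q" for p q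
    by (rule fps_ext) (simp add: TQ_def additive)
  have TQ_mult: "TQ (p * q) = TQ p * TQ q" for p q
    by (rule fps_ext) (simp add: TQ_def cartan sum_antidiagonal fps_mult_nth)
  have TQ_1: "TQ 1 = 1"
    by (rule fps_ext) (simp add: TQ_def unit)
  have TQ_monom: "TQ (monom 1 N) = generator_series A ^ N" for N
  proof (induction N)
    case 0
    then show ?case using TQ_1 by (simp add: monom_0 one_pCons)
  next
    case (Suc N)
    have "monom 1 (Suc N) = monom (1::bit) 1 * monom 1 N" by (simp add: mult_monom)
    then show ?case using Suc by (simp only: TQ_mult gen power_Suc)
  qed
  have "TQ p = total_operation A p" for p
  proof (induction p rule: bit_poly_additive_induct)
    case zero
    have "TQ 0 = TQ 0 + TQ 0" using TQ_add[of 0 0] by (simp only: add_0_left)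
    then have "TQ 0 = 0" by (metis add_cancel_right_right)
    then show ?case by simp
  next
    case (add p q)
    then show ?case by (simp only: TQ_add total_operation_add)
  next
    case (monom N)
    show ?case by (simp add: TQ_monom total_operation_monom flip: one_pCons)
  qed
  then have "Q i p = operation A i p" for i p
    by (simp add: operation_def TQ_def flip: \<open>\<And>p. TQ p = _\<close>)
  then show ?thesis by (auto simp: A_def fun_eq_iff)
qed

lemma adem_series_coefficient_series:
  assumes "dyer_lashof_algebra F2u_grading Q"
  shows "adem_series (coefficient_series Q)"
proof
  interpret dyer_lashof_algebra F2u_grading Q by fact
  define A where "A = coefficient_series Q"
  have Q: "Q = operation A" unfolding A_def by (rule dyer_lashof_algebra_eq_operation) fact
  have u: "monom 1 1 \<in> F2u_grading 2" by (auto simp: F2u_grading_def coeff_monom split: if_splits)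
  show "coefficient_series Q $ 0 = 0"
    using unstable[OF u, of 0] by (simp add: coefficient_series_def)
  show "coefficient_series Q $ 1 = 1"
    using square[OF u] by (simp add: coefficient_series_def monom_power coeff_monom power2_eq_square mult_monom numeral_2_eq_2)
  show "adem_relations (coefficient_series Q) 1"
    unfolding adem_relations_def A_def[symmetric]
  proof (intro allI impI)
    fix i j :: nat assume less: "i > 2 * j"
    then have "2 * i > 2 * (2 * j)" by simp
    from adem[OF this, of "monom 1 1"]
    show "(A ^ 1) $ j * (A ^ (1 + j)) $ i = (\<Sum>k | i \<le> 2 * k \<and> k \<le> i + j.
        of_nat ((k - j - 1) choose (2 * k - i)) * ((A ^ 1) $ k * (A ^ (1 + k)) $ (i + j - k)))"
      unfolding Q adem_sum_even[OF less] operation_monom_even mult_1_left by (simp only: monom_eq_iff)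
  qed
qed

theorem theorem5p2:
  shows "card {Q :: nat \<Rightarrow> bit poly \<Rightarrow> bit poly. dyer_lashof_algebra F2u_grading Q} = 4"
proof -
  have "{Q. dyer_lashof_algebra F2u_grading Q} = operation ` {A. adem_series A}"
    using dyer_lashof_algebra_operation dyer_lashof_algebra_eq_operation adem_series_coefficient_series
    by blast
  moreover have "inj operation"
    by (rule inj_on_inverseI) (rule coefficient_series_operation)
  ultimately show ?thesis
    by (metis adem_series_classification card_image card_series inj_on_subset subset_UNIV)
qed

end
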